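(* Suppose $\gcd(n,6)=2$, and let $G=G_n(x_0x_1x_{n/2-1})$. Then $$d(G^{\mathrm{ab}})=\begin{cases} 1 & \text{if }\gcd(n,16)=2,\\ 2 & \text{if }\gcd(n,16)=4\text{ or }16,\\ 3 & \text{if }\gcd(n,16)=8. \end{cases}$$
   Context: Here $n\ge 1$ is an integer. For an element $w=w(x_0,\dots,x_{n-1})$ of the free group on $x_0,\dots,x_{n-1}$, the cyclically presented group $G_n(w)$ is the group with presentation $\langle x_0,\dots,x_{n-1}\mid w(x_i,x_{i+1},\dots,x_{i+n-1})\ (0\le i<n)\rangle$, subscripts taken mod $n$. $G^{\mathrm{ab}}$ denotes the abelianization of $G$, and $d(H)$ denotes the minimum number of generators of a group $H$.
   Formalization: The case n = 4 is excluded because the claim fails there: gcd(4,6)=2 and gcd(4,16)=4, but the relators are x_i x_{i+1}^2, so G^ab is cyclic of order 15 and d(G^ab)=1, not 2. *)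

theory Defs
  imports "HOL-Algebra.Generated_Groups"
begin

section \<open>Free groups, as groups of reduced words\<close>

text \<open>The letter \<open>(x, True)\<close> stands for the generator \<open>x\<close> and \<open>(x, False)\<close> for its inverse.\<close>

type_synonym 'a letter = "'a \<times> bool"

definition inv_letter :: "'a letter \<Rightarrow> 'a letter"
  where "inv_letter a = (fst a, \<not> snd a)"

definition reduced :: "'a letter list \<Rightarrow> bool"
  where "reduced w \<longleftrightarrow> successively (\<lambda>a b. b \<noteq> inv_letter a) w"

fun cons_reduce :: "'a letter \<Rightarrow> 'a letter list \<Rightarrow> 'a letter list" where
  "cons_reduce a [] = [a]"
| "cons_reduce a (b # w) = (if b = inv_letter a then w else a # b # w)"

definition free_group :: "'a set \<Rightarrow> 'a letter list monoid"
  where "free_group S =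
    \<lparr>carrier = {w. reduced w \<and> set w \<subseteq> S \<times> UNIV},
     monoid.mult = (\<lambda>u v. foldr cons_reduce u v),
     one = []\<rparr>"

definition free_gen :: "'a \<Rightarrow> 'a letter list"
  where "free_gen x = [(x, True)]"

lemma inv_letter_inv_letter [simp]: "inv_letter (inv_letter a) = a"
  by (simp add: inv_letter_def)

lemma inv_letter_neq [simp]: "inv_letter a \<noteq> a" "a \<noteq> inv_letter a"
  by (auto simp: inv_letter_def prod_eq_iff)

lemma inv_letter_inject [simp]: "inv_letter a = inv_letter b \<longleftrightarrow> a = b"
  by (metis inv_letter_inv_letter)

lemma inv_letter_in_iff [simp]: "inv_letter a \<in> S \<times> UNIV \<longleftrightarrow> a \<in> S \<times> UNIV"
  by (simp add: inv_letter_def mem_Times_iff)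

lemma reduced_Nil [simp]: "reduced []"
  by (simp add: reduced_def)

lemma reduced_ConsD: "reduced (a # w) \<Longrightarrow> reduced w"
  by (cases w) (auto simp: reduced_def)

lemma reduced_cons_reduce: "reduced w \<Longrightarrow> reduced (cons_reduce a w)"
  by (cases w) (auto simp: reduced_def successively_Cons)

lemma reduced_foldr: "reduced v \<Longrightarrow> reduced (foldr cons_reduce u v)"
  by (induction u) (auto intro: reduced_cons_reduce)

lemma set_cons_reduce: "set (cons_reduce a w) \<subseteq> insert a (set w)"
  by (cases w) auto

lemma set_foldr_cons_reduce: "set (foldr cons_reduce u v) \<subseteq> set u \<union> set v"
proof (induction u)
  case (Cons a u)
  then show ?case using set_cons_reduce[of a "foldr cons_reduce u v"] by auto
qed simp

lemma cons_reduce_inv: "reduced w \<Longrightarrow> cons_reduce a (cons_reduce (inv_letter a) w) = w"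
  by (cases w; cases "tl w") (auto simp: reduced_def successively_Cons)

lemma cons_reduce_reduced: "reduced (a # w) \<Longrightarrow> cons_reduce a w = a # w"
  by (cases w) (auto simp: reduced_def)

lemma foldr_cons_reduce_Nil: "reduced u \<Longrightarrow> foldr cons_reduce u [] = u"
proof (induction u)
  case (Cons a u)
  then show ?case using cons_reduce_reduced[of a u] reduced_ConsD[of a u] by simp
qed simp

lemma foldr_cons_reduce:
  assumes "reduced w"
  shows "foldr cons_reduce (cons_reduce a v) w = cons_reduce a (foldr cons_reduce v w)"
proof (cases v)
  case (Cons b v')
  then show ?thesis
    using cons_reduce_inv[OF reduced_foldr[OF assms], of a v'] by auto
qed simp

lemma foldr_cons_reduce_assoc:
  "reduced w \<Longrightarrow> foldr cons_reduce (foldr cons_reduce u v) w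
     = foldr cons_reduce u (foldr cons_reduce v w)"
  by (induction u) (simp_all add: foldr_cons_reduce)

lemma foldr_cons_reduce_left_inverse:
  "reduced v \<Longrightarrow> foldr cons_reduce (rev (map inv_letter u)) (foldr cons_reduce u v) = v"
proof (induction u arbitrary: v)
  case (Cons a u)
  have "cons_reduce (inv_letter a) (cons_reduce a (foldr cons_reduce u v)) = foldr cons_reduce u v"
    using cons_reduce_inv[OF reduced_foldr[OF Cons.prems], of "inv_letter a" u] by simp
  then show ?case using Cons by simp
qed simp

lemma reduced_inverse: "reduced u \<Longrightarrow> reduced (rev (map inv_letter u))"
proof -
  have eq: "\<And>a b. inv_letter a \<noteq> inv_letter (inv_letter b) \<longleftrightarrow> b \<noteq> inv_letter a" by auto
  assume "reduced u"
  then show ?thesis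
    by (simp add: reduced_def successively_map) (metis (mono_tags, lifting) inv_letter_inv_letter successively_cong)
qed

lemma free_group_is_group: "group (free_group S)"
proof (rule groupI)
  fix u assume "u \<in> carrier (free_group S)"
  then have u: "reduced u" "set u \<subseteq> S \<times> UNIV" by (auto simp: free_group_def)
  let ?v = "rev (map inv_letter u)"
  have "foldr cons_reduce ?v u = []"
    using foldr_cons_reduce_left_inverse[of "[]" u] foldr_cons_reduce_Nil[OF u(1)] by simp
  moreover have "set ?v \<subseteq> S \<times> UNIV" using u(2) by (auto simp: inv_letter_def)
  ultimately show "\<exists>v\<in>carrier (free_group S). v \<otimes>\<^bsub>free_group S\<^esub> u = \<one>\<^bsub>free_group S\<^esub>"
    using reduced_inverse[OF u(1)] by (intro bexI[of _ ?v]) (auto simp: free_group_def)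
next
  fix u v assume "u \<in> carrier (free_group S)" "v \<in> carrier (free_group S)"
  then show "u \<otimes>\<^bsub>free_group S\<^esub> v \<in> carrier (free_group S)"
    using set_foldr_cons_reduce[of u v] by (auto simp: free_group_def intro: reduced_foldr)
qed (auto simp: free_group_def foldr_cons_reduce_assoc)

section \<open>Presentations\<close>

definition normal_closure :: "('a, 'b) monoid_scheme \<Rightarrow> 'a set \<Rightarrow> 'a set"
  where "normal_closure G R =
    generate G {g \<otimes>\<^bsub>G\<^esub> r \<otimes>\<^bsub>G\<^esub> inv\<^bsub>G\<^esub> g | g r. g \<in> carrier G \<and> r \<in> R}"

definition presented_group :: "'a set \<Rightarrow> 'a letter list set \<Rightarrow> 'a letter list set monoid"
  where "presented_group S R = free_group S Mod normal_closure (free_group S) R"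

lemma (in group) normal_closure_normal:
  assumes "R \<subseteq> carrier G"
  shows "normal_closure G R \<lhd> G"
  unfolding normal_closure_def
proof (rule normal_generateI)
  fix h k
  assume "h \<in> {g \<otimes> r \<otimes> inv g | g r. g \<in> carrier G \<and> r \<in> R}" and k: "k \<in> carrier G"
  then obtain g r where gr: "g \<in> carrier G" "r \<in> R" "h = g \<otimes> r \<otimes> inv g" by auto
  with assms k have "k \<otimes> h \<otimes> inv k = (k \<otimes> g) \<otimes> r \<otimes> inv (k \<otimes> g)"
    by (simp add: subset_eq inv_mult_group m_assoc)
  with gr k show "k \<otimes> h \<otimes> inv k \<in> {g \<otimes> r \<otimes> inv g | g r. g \<in> carrier G \<and> r \<in> R}" by blast
qed (use assms in auto)

lemma presented_group_is_group:
  "R \<subseteq> carrier (free_group S) \<Longrightarrow> group (presented_group S R)"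
  unfolding presented_group_def
  by (intro normal.factorgroup_is_group group.normal_closure_normal free_group_is_group)

section \<open>Cyclically presented groups\<close>

text \<open>\<open>shift_word n i w\<close> is \<open>w(x\<^sub>i, x\<^sub>i\<^sub>+\<^sub>1, \<dots>, x\<^sub>i\<^sub>+\<^sub>n\<^sub>-\<^sub>1)\<close>, subscripts mod \<open>n\<close>. It is again reduced when \<open>w\<close>
  is, because \<open>j \<mapsto> (i + j) mod n\<close> permutes \<open>{..<n}\<close>.\<close>

definition shift_word :: "nat \<Rightarrow> nat \<Rightarrow> nat letter list \<Rightarrow> nat letter list"
  where "shift_word n i w = map (\<lambda>(j, e). ((i + j) mod n, e)) w"

definition cyclically_presented_group :: "nat \<Rightarrow> nat letter list \<Rightarrow> nat letter list set monoid"
  where "cyclically_presented_group n w = presented_group {..<n} {shift_word n i w | i. i < n}"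

text \<open>For \<open>w = x\<^sub>0 x\<^sub>1 x\<^bsub>n/2-1\<^esub>\<close> the case \<open>n = 4\<close> is degenerate: the relators are \<open>x\<^sub>i x\<^sub>i\<^sub>+\<^sub>1\<^sup>2\<close>,
  so the group is cyclic (of order 15), although \<open>gcd(4, 16) = 4\<close>.\<close>

lemma shift_word_in_carrier:
  assumes "w \<in> carrier (free_group {..<n})"
  shows "shift_word n i w \<in> carrier (free_group {..<n})"
proof -
  have red: "reduced w" and w: "set w \<subseteq> {..<n} \<times> UNIV"
    using assms by (auto simp: free_group_def)
  have le: "j = k" if "(i + j) mod n = (i + k) mod n" "k \<le> j" "j < n" for j k
  proof -
    have "n dvd j - k" using that mod_eq_dvd_iff_nat[of "i + k" "i + j" n] by simp
    then show ?thesis using that nat_dvd_not_less[of "j - k" n] by force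
  qed
  have inj: "j = k" if "(i + j) mod n = (i + k) mod n" "j < n" "k < n" for j k
    using le[of j k] le[of k j] that by (cases "k \<le> j") auto
  have "reduced (shift_word n i w)"
    using red w
  proof (induction w)
    case (Cons a w)
    then show ?case
      by (cases w) (auto simp: shift_word_def reduced_def inv_letter_def dest: inj)
  qed (simp add: shift_word_def)
  moreover have "set (shift_word n i w) \<subseteq> {..<n} \<times> UNIV"
    using w by (cases "n = 0") (auto simp: shift_word_def)
  ultimately show ?thesis by (auto simp: free_group_def)
qed

lemma cyclically_presented_group_is_group:
  "w \<in> carrier (free_group {..<n}) \<Longrightarrow> group (cyclically_presented_group n w)"
  unfolding cyclically_presented_group_def
  by (rule presented_group_is_group) (auto intro: shift_word_in_carrier)

section \<open>Abelianization and minimum number of generators\<close>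

definition abelianization :: "('a, 'b) monoid_scheme \<Rightarrow> 'a set monoid"
  where "abelianization G = G Mod derived G (carrier G)"

text \<open>Only meaningful when \<open>G\<close> is finitely generated (otherwise the \<open>LEAST\<close> is unspecified).\<close>

definition min_generators :: "('a, 'b) monoid_scheme \<Rightarrow> nat"
  where "min_generators G =
    (LEAST k. \<exists>S. S \<subseteq> carrier G \<and> finite S \<and> card S = k \<and> generate G S = carrier G)"

end

theory Submission
  imports Defs "HOL-Algebra.Elementary_Groups" "HOL-Algebra.FiniteProduct"
    "HOL-Computational_Algebra.Polynomial"
begin

text \<open>Write \<open>n = 2m\<close>. The abelianization is the additive group of the ring
  \<open>\<int>[x]/(x\<^sup>2\<^sup>m - 1, 1 + x + x\<^sup>m\<^sup>-\<^sup>1)\<close>, where \<open>x\<^sup>m = -(x\<^sup>2 + x)\<close> and hence \<open>(x\<^sup>2 + x - 1)(x\<^sup>2 + x + 1) = 0\<close>.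
  As 3 does not divide \<open>m\<close>, 2 is a unit, so the ring splits into a factor \<open>\<int>/3\<close> and a factor
  \<open>\<int>[x]/(x\<^sup>2 + x - 1, x\<^sup>m + 1)\<close>, which has rank at most 2 and is governed by Fibonacci numbers.
  Its order is prime to 3 unless \<open>m \<equiv> 4 (mod 8)\<close>, and it is cyclic when \<open>m\<close> is odd; this bounds the number
  of generators from above. For \<open>m = 2k\<close>, \<open>x\<^sup>m + 1\<close> is divisible by the Fibonacci number \<open>F\<^sub>k\<close>
  (\<open>k\<close> odd) or the Lucas number \<open>L\<^sub>k\<close> (\<open>k\<close> even), which yields quotients \<open>(\<int>/N)\<^sup>2\<close>, and
  \<open>(\<int>/3)\<^sup>3\<close> when \<open>m \<equiv> 4 (mod 8)\<close>; these bound it from below.\<close>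

section \<open>Signed Fibonacci numbers\<close>

text \<open>These are the signed Fibonacci numbers \<open>(-1)\<^sup>i\<^sup>+\<^sup>1 F\<^sub>i\<close>: modulo \<open>x\<^sup>2 + x - 1\<close> the power \<open>x\<^sup>i\<close> reduces to
  \<open>nfib i * x + (nfib i + nfib (i + 1))\<close>.\<close>

fun nfib :: "nat \<Rightarrow> int" where
  "nfib 0 = 0"
| "nfib (Suc 0) = 1"
| "nfib (Suc (Suc i)) = nfib i - nfib (Suc i)"

text \<open>The first identity compares coefficients of \<open>x\<close> in
  \<open>x^i * x^j\<close>, with all powers written as above. The second makes the two-term
  recurrence usable in the induction.\<close>

lemma nfib_add:
  "nfib (i + j) = nfib (Suc i) * nfib j + nfib i * nfib (Suc j) + nfib i * nfib j
   \<and> nfib (Suc (i + j)) = nfib (Suc (Suc i)) * nfib j + nfib (Suc i) * nfib (Suc j) + nfib (Suc i) * nfib j"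
  by (induction i) (simp_all add: algebra_simps)

text \<open>The second factor is \<open>(-1)^k\<close> times the Lucas number
  \<open>L_k\<close>.\<close>

lemma nfib_double: "nfib (2 * k) = nfib k * (2 * nfib (Suc k) + nfib k)"
  unfolding mult_2[of k] nfib_add[THEN conjunct1] by (simp add: algebra_simps)

lemma nfib_Suc_double: "nfib (Suc (2 * k)) = nfib (Suc k) ^ 2 + nfib k ^ 2"
  unfolding mult_2[of k] nfib_add[THEN conjunct2] by (simp add: algebra_simps power2_eq_square)

text \<open>Cassini's identity: the left side is the norm of \<open>x^k\<close> modulo
  \<open>x^2 + x - 1\<close>, and \<open>x\<close> has norm -1.\<close>

lemma nfib_cassini: "nfib (Suc k) ^ 2 + nfib k * nfib (Suc k) - nfib k ^ 2 = (-1) ^ k"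
  by (induction k) (simp_all add: algebra_simps power2_eq_square)

text \<open>Signs and growth, used to show that the moduli of the lower bounds exceed 1.\<close>

lemma nfib_sign: "nfib (2 * j) \<le> - int j \<and> nfib (Suc (2 * j)) \<ge> int j + 1"
  by (induction j) simp_all

lemma nfib_mod3: "nfib (8 * q + r) mod 3 = nfib r mod 3"
proof (induction q)
  case (Suc q)
  have "nfib (8 + i) = 3 * (4 * nfib i - 7 * nfib (Suc i)) + nfib i" for i
    by (simp add: numeral_eq_Suc)
  then have "nfib (8 + i) mod 3 = nfib i mod 3" for i
    by (metis mod_mult_self4)
  from this[of "8 * q + r"] Suc show ?case
    by (simp add: add.assoc)
qed simp

lemma even_nfib_iff: "even (nfib k) \<longleftrightarrow> 3 dvd k"
proof (induction k rule: less_induct)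
  case (less k)
  have "nfib (3 + i) = 2 * nfib (Suc i) - nfib i" for i
    by (simp add: numeral_eq_Suc)
  then have step: "even (nfib (3 + i)) \<longleftrightarrow> even (nfib i)" for i
    by simp
  consider "k = 0" | "k = 1" | "k = 2" | "k \<ge> 3" by linarith
  then show ?case
  proof cases
    case 4
    then show ?thesis
      using less[of "k - 3"] step[of "k - 3"] dvd_minus_self[of 3 k] by auto
  qed (simp_all add: numeral_2_eq_2 nat_dvd_not_less)
qed

lemma nfib_numeral:
  "nfib 2 = -1" "nfib 3 = 2" "nfib 4 = -3" "nfib 5 = 5" "nfib 6 = -8" "nfib 7 = 13" "nfib 8 = -21"
  by (simp_all add: eval_nat_numeral)

text \<open>\<open>a\<^sup>2 - a b - b\<^sup>2\<close> is the norm of \<open>a + b x = x\<^sup>m + 1\<close> in \<open>\<int>[x]/(x\<^sup>2 + x - 1)\<close>.\<close>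

lemma nfib_norm_not_dvd_3:
  assumes "m mod 8 \<noteq> 4" "a = 1 + nfib m + nfib (Suc m)" "b = nfib m"
  shows "\<not> 3 dvd a\<^sup>2 - a * b - b\<^sup>2"
proof
  let ?r = "m mod 8"
  \<comment> \<open>As \<open>nfib\<close> has period 8 modulo 3, the norm modulo 3 depends only on
    \<open>?r\<close>, which leaves seven residues to evaluate.\<close>
  have m: "nfib m mod 3 = nfib ?r mod 3" "nfib (Suc m) mod 3 = nfib (Suc ?r) mod 3"
    using nfib_mod3[of "m div 8" ?r] nfib_mod3[of "m div 8" "Suc ?r"] by simp_all
  have a: "a mod 3 = (1 + nfib ?r + nfib (Suc ?r)) mod 3"
    unfolding assms(2) by (intro mod_add_cong m refl)
  have b: "b mod 3 = nfib ?r mod 3"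
    unfolding assms(3) by (rule m)
  have "(a\<^sup>2 - a * b - b\<^sup>2) mod 3 =
      ((1 + nfib ?r + nfib (Suc ?r))\<^sup>2 - (1 + nfib ?r + nfib (Suc ?r)) * nfib ?r - (nfib ?r)\<^sup>2) mod 3"
    unfolding power2_eq_square by (intro mod_diff_cong mod_mult_cong a b)
  moreover assume "3 dvd a\<^sup>2 - a * b - b\<^sup>2"
  ultimately have eq: "((1 + nfib ?r + nfib (Suc ?r))\<^sup>2 - (1 + nfib ?r + nfib (Suc ?r)) * nfib ?r - (nfib ?r)\<^sup>2) mod 3 = 0"
    by (metis dvd_imp_mod_0)
  have "?r < 8" by simp
  with assms(1) consider "?r = 0" | "?r = 1" | "?r = 2" | "?r = 3" | "?r = 5" | "?r = 6" | "?r = 7"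
    by linarith
  then show False
    by cases (use eq in \<open>simp_all add: nfib_numeral\<close>)
qed

text \<open>For odd \<open>m\<close>, Cassini's identity writes 2 as a combination of the two
  numbers, and \<open>nfib m\<close> is odd because 3 does not divide \<open>m\<close>.\<close>

lemma coprime_nfib:
  assumes "odd m" "\<not> 3 dvd m"
  shows "coprime (1 + nfib m + nfib (Suc m)) (nfib m)"
proof (rule coprimeI)
  fix d :: int
  assume d: "d dvd 1 + nfib m + nfib (Suc m)" "d dvd nfib m"
  have "d dvd (1 + nfib m + nfib (Suc m)) - nfib m"
    using d by (rule dvd_diff)
  then have "d dvd 1 + nfib (Suc m)" by (simp add: algebra_simps)
  then have "d dvd nfib m * (nfib m - nfib (Suc m)) - (1 + nfib (Suc m)) * (nfib (Suc m) - 1)"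
    using d by (intro dvd_diff dvd_mult2)
  also have "\<dots> = 2"
    using nfib_cassini[of m] assms by (simp add: algebra_simps power2_eq_square)
  finally have "d dvd 2" .
  moreover have "\<not> 2 dvd d"
    using d(2) even_nfib_iff[of m] assms(2) dvd_trans[of 2 d "nfib m"] by auto
  moreover have "coprime d 2"
    using calculation(2) by (simp add: coprime_commute)
  ultimately show "is_unit d"
    using coprime_absorb_left[of d 2] by simp
qed

section \<open>The relation ideal\<close>

text \<open>\<open>x^3 - 1\<close> is a multiple of \<open>x^2 + x + 1\<close>. The explicit
  cofactor lets later congruences become polynomial identities.\<close>

lemma power_3_mult_eq:
  fixes x :: "'r::comm_ring_1"
  shows "\<exists>s. x ^ (3 * q) = 1 + (x\<^sup>2 + x + 1) * s"
proof (induction q)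
  case (Suc q)
  then obtain s where s: "x ^ (3 * q) = 1 + (x\<^sup>2 + x + 1) * s" by blast
  have "x ^ (3 * Suc q) = x ^ 3 * x ^ (3 * q)"
    by (simp add: power_add)
  also have "\<dots> = 1 + (x\<^sup>2 + x + 1) * (x - 1 + x ^ 3 * s)"
    unfolding s by (simp add: algebra_simps power2_eq_square power3_eq_cube)
  finally show ?case by blast
qed (auto intro: exI[of _ 0])

lemma power_eq_nfib:
  fixes x :: "'r::comm_ring_1"
  shows "\<exists>t. x ^ i = of_int (nfib i + nfib (Suc i)) + of_int (nfib i) * x + (x\<^sup>2 + x - 1) * t"
proof (induction i)
  case (Suc i)
  then obtain t where t: "x ^ i = of_int (nfib i + nfib (Suc i)) + of_int (nfib i) * x + (x\<^sup>2 + x - 1) * t"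
    by blast
  have "x ^ Suc i = of_int (nfib (Suc i) + nfib (Suc (Suc i))) + of_int (nfib (Suc i)) * x
      + (x\<^sup>2 + x - 1) * (x * t + of_int (nfib i))"
    unfolding power_Suc t by (simp add: algebra_simps power2_eq_square)
  then show ?case by blast
qed (auto intro: exI[of _ 0])

text \<open>The quotient ring is never formed: congruences are memberships in \<open>J\<close>,
  which may be any ideal containing the two relations. Zero and negatives come from
  \<open>mult\<close>.\<close>

locale relation_ideal =
  fixes J :: "'r::comm_ring_1 set" and x :: 'r and m :: nat
  assumes add: "\<And>p q. p \<in> J \<Longrightarrow> q \<in> J \<Longrightarrow> p + q \<in> J"
    and mult: "\<And>p q. p \<in> J \<Longrightarrow> q * p \<in> J"
    and periodic: "x ^ (2 * m) - 1 \<in> J"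
    and relation: "1 + x + x ^ (m - 1) \<in> J"
    and m: "m \<ge> 1" "\<not> 3 dvd m"
begin

text \<open>Once the coefficients are supplied, membership in \<open>J\<close> is reduced to a ring
  identity.\<close>

lemma comb2: "g \<in> J \<Longrightarrow> h \<in> J \<Longrightarrow> p = a * g + b * h \<Longrightarrow> p \<in> J"
  using add mult by blast

lemma comb3: "g \<in> J \<Longrightarrow> h \<in> J \<Longrightarrow> k \<in> J \<Longrightarrow> p = a * g + b * h + c * k \<Longrightarrow> p \<in> J"
  using add mult by blast

lemma relation_power: "x ^ m + x\<^sup>2 + x \<in> J"
proof -
  have "x * x ^ (m - 1) = x ^ m"
    using m by (simp add: power_eq_if)
  then have "x * (1 + x + x ^ (m - 1)) = x ^ m + x\<^sup>2 + x"
    by (simp add: algebra_simps power2_eq_square)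
  then show ?thesis
    using mult[OF relation, of x] by simp
qed

lemma factors: "(x\<^sup>2 + x - 1) * (x\<^sup>2 + x + 1) \<in> J"
proof (rule comb2[OF relation_power periodic])
  have "x ^ (2 * m) = x ^ m * x ^ m"
    by (simp add: mult_2 power_add)
  then show "(x\<^sup>2 + x - 1) * (x\<^sup>2 + x + 1)
      = (x\<^sup>2 + x - x ^ m) * (x ^ m + x\<^sup>2 + x) + 1 * (x ^ (2 * m) - 1)"
    by (simp add: algebra_simps power2_eq_square)
qed

text \<open>Modulo \<open>x^2 + x + 1\<close> the power \<open>x^m\<close> is \<open>x\<close> or
  \<open>x^2\<close>, according to \<open>m mod 3\<close>. Substituting this into
  \<open>relation_power\<close> gives the first fact of each case.\<close>

lemma reduced_power:
  obtains s where "x * (x + 2 + (x\<^sup>2 + x + 1) * s) \<in> J"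
    "x ^ m = x * (1 + (x\<^sup>2 + x + 1) * s)"
  | s where "x * (2 * x + 1 + x * (x\<^sup>2 + x + 1) * s) \<in> J"
    "x ^ m = x\<^sup>2 * (1 + (x\<^sup>2 + x + 1) * s)"
proof -
  obtain s where s: "x ^ (3 * (m div 3)) = 1 + (x\<^sup>2 + x + 1) * s"
    using power_3_mult_eq by blast
  have "x ^ m = x ^ (m mod 3) * x ^ (3 * (m div 3))"
    by (simp flip: power_add)
  then have xm: "x ^ m = x ^ (m mod 3) * (1 + (x\<^sup>2 + x + 1) * s)"
    unfolding s .
  have "m mod 3 = 1 \<or> m mod 3 = 2"
    using m(2) by (simp add: dvd_eq_mod_eq_0, linarith)
  then show thesis
  proof
    assume r: "m mod 3 = 1"
    then have "x ^ m + x\<^sup>2 + x = x * (x + 2 + (x\<^sup>2 + x + 1) * s)"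
      using xm by (simp add: algebra_simps power2_eq_square)
    then show thesis
      using that(1) relation_power xm r by simp
  next
    assume r: "m mod 3 = 2"
    then have "x ^ m + x\<^sup>2 + x = x * (2 * x + 1 + x * (x\<^sup>2 + x + 1) * s)"
      using xm by (simp add: algebra_simps power2_eq_square)
    then show thesis
      using that(2) relation_power xm r by simp
  qed
qed

lemma x_unit: "1 - x ^ (2 * m - 1) * x \<in> J"
proof -
  have "x ^ (2 * m - 1) * x = x ^ (2 * m)"
    using m by (cases "2 * m") simp_all
  then show ?thesis
    using mult[OF periodic, of "-1"] by simp
qed

text \<open>Modulo 2 the two factors coincide and their square vanishes, while the relation makes the
  factor itself a unit; so 2 is invertible and the two factors split the quotient.\<close>

lemma two_unit: "\<exists>h. 1 - 2 * h \<in> J"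
proof -
  define w where "w = x\<^sup>2 + x + 1"
  have ww: "w * w - 2 * w \<in> J"
    using factors unfolding w_def by (simp add: algebra_simps)
  have "\<exists>a b. 1 - 2 * a - w * b \<in> J"
    using reduced_power
  proof cases
    case (1 s)
    \<comment> \<open>\<open>?z\<close> inverts \<open>x\<close> modulo \<open>J\<close>, so
      multiplying the case hypothesis by \<open>?z * ?z\<close> leaves
      \<open>1 + 2 * ?z + w * ?z * s\<close>.\<close>
    let ?z = "x ^ (2 * m - 1)"
    have "1 - 2 * (- ?z) - w * (- (?z * s)) \<in> J"
      by (rule comb2[OF 1(1) x_unit, of _ "?z * ?z" "1 + 2 * ?z + w * ?z * s + ?z * x"])
         (simp add: w_def algebra_simps power2_eq_square)
    then show ?thesis by blast
  next
    case (2 s)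
    let ?z = "x ^ (2 * m - 1)"
    have "1 - 2 * (- x) - w * (- (x * s)) \<in> J"
      by (rule comb2[OF 2(1) x_unit, of _ ?z "1 + 2 * x + w * x * s"])
         (simp add: w_def algebra_simps power2_eq_square)
    then show ?thesis by blast
  qed
  then obtain a b where ab: "1 - 2 * a - w * b \<in> J" by blast
  \<comment> \<open>Square \<open>1 = 2 * a + w * b\<close> and replace \<open>w * w\<close> by
    \<open>2 * w\<close>.\<close>
  have "1 - 2 * (2 * a * a + 2 * a * w * b + w * b * b) \<in> J"
    by (rule comb2[OF ab ww, of _ "1 + 2 * a + w * b" "b * b"]) (simp add: algebra_simps)
  then show ?thesis by blast
qed

text \<open>On the summand of \<open>e1\<close> the power \<open>x\<^sup>m\<close> acts as \<open>-1\<close>; the summand of \<open>e2\<close> is a quotient of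
  \<open>\<int>/3\<close> on which \<open>x\<close> acts trivially.\<close>

lemma splitting:
  obtains e1 e2 where "1 - (e1 + e2) \<in> J" "(x\<^sup>2 + x - 1) * e1 \<in> J" "(x - 1) * e2 \<in> J" "3 * e2 \<in> J"
    "(of_int (1 + nfib m + nfib (Suc m)) + of_int (nfib m) * x) * e1 \<in> J"
proof -
  obtain h where h: "1 - 2 * h \<in> J" using two_unit by blast
  \<comment> \<open>The two factors differ by 2 and \<open>h\<close> inverts 2, so their multiples
    by \<open>h\<close> differ by 1.\<close>
  define e1 where "e1 = h * (x\<^sup>2 + x + 1)"
  define e2 where "e2 = - (h * (x\<^sup>2 + x - 1))"
  have u: "(x\<^sup>2 + x - 1) * e1 \<in> J"
    using mult[OF factors, of h] by (simp add: e1_def mult_ac)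
  have w: "(x\<^sup>2 + x + 1) * e2 \<in> J"
    using mult[OF factors, of "- h"] by (simp add: e2_def mult_ac)
  have e: "1 - (e1 + e2) \<in> J"
    using h by (simp add: e1_def e2_def algebra_simps)
  \<comment> \<open>On \<open>e2\<close> the power \<open>x^m\<close> acts as \<open>x\<close> or
    \<open>x^2\<close>, so \<open>x^2 + 2 * x\<close> or \<open>2 * x^2 + x\<close> kills
    \<open>e2\<close>. Together with \<open>x^2 + x + 1\<close>, either one yields
    \<open>x - 1\<close>.\<close>
  have x: "(x - 1) * e2 \<in> J"
    using reduced_power
  proof cases
    case (1 s)
    show ?thesis
      by (rule comb2[OF relation_power w, of _ e2 "- (1 + x * s)"])
        (simp add: 1 algebra_simps power2_eq_square)
  next
    case (2 s)
    show ?thesis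
      by (rule comb2[OF relation_power w, of _ "- x * e2" "x - 1 + x * (1 + x\<^sup>2 * s)"])
        (simp add: 2 algebra_simps power2_eq_square)
  qed
  \<comment> \<open>The value of \<open>x^2 + x + 1\<close> at \<open>x = 1\<close> is 3.\<close>
  have "3 * e2 \<in> J"
    by (rule comb2[OF w x, of _ 1 "- (x + 2)"]) (simp add: algebra_simps power2_eq_square)
  moreover obtain t where
    t: "x ^ m = of_int (nfib m + nfib (Suc m)) + of_int (nfib m) * x + (x\<^sup>2 + x - 1) * t"
    using power_eq_nfib by blast
  have "(of_int (1 + nfib m + nfib (Suc m)) + of_int (nfib m) * x) * e1 \<in> J"
    by (rule comb2[OF relation_power u, of _ e1 "- (1 + t)"])
      (simp add: t algebra_simps power2_eq_square)
  ultimately show thesis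
    using that e u x by blast
qed

end

section \<open>Additive generators modulo the ideal\<close>

text \<open>For nonempty \<open>J\<close>, this is generation of the additive group modulo
  \<open>J\<close>. Quantifying over subgroups \<open>M\<close> lets preimages of subgroups be used
  directly.\<close>

definition spans_modulo :: "'r::comm_ring_1 set \<Rightarrow> 'r set \<Rightarrow> bool" where
  "spans_modulo J S \<longleftrightarrow>
    (\<forall>M. J \<subseteq> M \<longrightarrow> S \<subseteq> M \<longrightarrow> (\<forall>p\<in>M. \<forall>q\<in>M. p - q \<in> M) \<longrightarrow> M = UNIV)"

lemma of_int_mult_closed:
  fixes M :: "'r::comm_ring_1 set"
  assumes "\<And>p q. p \<in> M \<Longrightarrow> q \<in> M \<Longrightarrow> p - q \<in> M" "p \<in> M"
  shows "of_int k * p \<in> M"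
proof (induction k rule: int_induct[where k = 0])
  case base
  then show ?case using assms(1)[OF assms(2) assms(2)] by simp
next
  case (step1 i)
  have "0 - p \<in> M" using assms by (metis cancel_comm_monoid_add_class.diff_cancel)
  then have "of_int i * p - (0 - p) \<in> M" using assms(1) step1 by blast
  then show ?case by (simp add: algebra_simps)
next
  case (step2 i)
  then have "of_int i * p - p \<in> M" using assms by blast
  then show ?case by (simp add: algebra_simps)
qed

text \<open>The extra assumption says that every element is an integer polynomial in
  \<open>x\<close>, in the form of an induction along Horner's scheme.\<close>

locale generated_relation_ideal = relation_ideal J x m for J :: "'r::comm_ring_1 set" and x m +
  assumes generated: "\<And>P p. P 0 \<Longrightarrow> (\<And>c p. P p \<Longrightarrow> P (of_int c + x * p)) \<Longrightarrow> P p"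
begin

text \<open>Modulo \<open>x^2 + x - 1\<close> the conjugate of \<open>x\<close> is
  \<open>-1 - x\<close>. Multiplying \<open>a + b * x\<close> by its conjugate gives the
  norm.\<close>

lemma annihilator:
  assumes u: "(x\<^sup>2 + x - 1) * e \<in> J" and v: "(of_int a + of_int b * x) * e \<in> J"
  shows "of_int (a\<^sup>2 - a * b - b\<^sup>2) * e \<in> J"
  by (rule comb2[OF v u, of _ "of_int (a - b) - of_int b * x" "of_int (b\<^sup>2)"])
    (simp add: algebra_simps power2_eq_square)

text \<open>The multiplier \<open>N * N\<close> kills \<open>g\<close> and, being 1 modulo 3, fixes
  \<open>e\<close>.\<close>

lemma merge_coprime_orders:
  assumes N: "of_int N * g \<in> J" "\<not> 3 dvd N" and e: "3 * e \<in> J"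
  shows "\<exists>k. e - of_int k * (g + e) \<in> J"
proof -
  have "N mod 3 = 1 \<or> N mod 3 = 2" using N(2) by (simp add: dvd_eq_mod_eq_0, linarith)
  then have "(N * N) mod 3 = 1" by (auto simp: mod_mult_eq[of N 3 N, symmetric])
  then have "N * N = 1 + 3 * (N * N div 3)"
    by (metis add.commute mult_div_mod_eq)
  then obtain t where t: "N * N = 1 + 3 * t" by blast
  have "of_int (N * N) * g \<in> J"
    using mult[OF N(1), of "of_int N"] by (simp add: mult.assoc)
  then have g: "of_int (1 + 3 * t) * g \<in> J" unfolding t .
  have "e - of_int (1 + 3 * t) * (g + e) \<in> J"
    by (rule comb2[OF g e, of _ "-1" "- of_int t"]) (simp add: algebra_simps)
  then show ?thesis by blast
qed

text \<open>To pass from \<open>S\<close> to \<open>T\<close>, it suffices to reach \<open>S\<close>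
  from \<open>T\<close> by sums, integer multiples and changes modulo \<open>J\<close>.\<close>

lemma spans_modulo_trans:
  assumes "spans_modulo J S"
    and "\<And>M s. \<lbrakk>T \<subseteq> M; \<And>p q. p \<in> M \<Longrightarrow> q \<in> M \<Longrightarrow> p + q \<in> M;
      \<And>k p. p \<in> M \<Longrightarrow> of_int k * p \<in> M; \<And>p q. q \<in> M \<Longrightarrow> p - q \<in> J \<Longrightarrow> p \<in> M; s \<in> S\<rbrakk> \<Longrightarrow> s \<in> M"
  shows "spans_modulo J T"
  unfolding spans_modulo_def
proof (intro allI impI)
  fix M
  assume J: "J \<subseteq> M" and T: "T \<subseteq> M" and M: "\<forall>p\<in>M. \<forall>q\<in>M. p - q \<in> M"
  have scale: "of_int k * q \<in> M" if "q \<in> M" for k q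
    using of_int_mult_closed M that by blast
  have plus: "q + r \<in> M" if "q \<in> M" "r \<in> M" for q r
    using M that scale[of r "-1"] by (metis diff_minus_eq_add mult_minus1 of_int_1 of_int_minus)
  have mod_J: "p \<in> M" if "q \<in> M" "p - q \<in> J" for p q
    using J plus that by (metis diff_add_cancel subsetD)
  have "s \<in> M" if "s \<in> S" for s
    by (rule assms(2)[OF T _ _ _ that]) (blast intro: plus scale mod_J)+
  then show "M = UNIV"
    using assms(1) J M by (simp add: spans_modulo_def subset_iff)
qed

text \<open>Split \<open>p\<close> as \<open>p * e1 + p * e2\<close>. By Horner induction,
  \<open>x^2 = 1 - x\<close> reduces the first term to a linear polynomial times \<open>e1\<close>,
  and \<open>x = 1\<close> reduces the second to an integer times \<open>e2\<close>.\<close>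

lemma spans_three:
  assumes e: "1 - (e1 + e2) \<in> J" and u: "(x\<^sup>2 + x - 1) * e1 \<in> J" and v: "(x - 1) * e2 \<in> J"
  shows "spans_modulo J {e1, x * e1, e2}"
proof (rule spans_modulo_trans)
  show "spans_modulo J UNIV" by (auto simp: spans_modulo_def)
  fix M p
  assume "{e1, x * e1, e2} \<subseteq> M"
    and plus: "\<And>p q. p \<in> M \<Longrightarrow> q \<in> M \<Longrightarrow> p + q \<in> M"
    and scale: "\<And>k p. p \<in> M \<Longrightarrow> of_int k * p \<in> M"
    and J: "\<And>p q. q \<in> M \<Longrightarrow> p - q \<in> J \<Longrightarrow> p \<in> M"
  then have S: "e1 \<in> M" "x * e1 \<in> M" "e2 \<in> M" by auto
  have "\<exists>a b. p * e1 - (of_int a + of_int b * x) * e1 \<in> J"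
  proof (induction p rule: generated)
    case 1
    then show ?case using mult[OF e, of 0] by (auto intro!: exI[of _ 0])
  next
    case (2 c p)
    then obtain a b where ab: "p * e1 - (of_int a + of_int b * x) * e1 \<in> J" by blast
    have "(of_int c + x * p) * e1 - (of_int (c + b) + of_int (a - b) * x) * e1 \<in> J"
      by (rule comb2[OF ab u, of _ x "of_int b"]) (simp add: algebra_simps power2_eq_square)
    then show ?case by blast
  qed
  then obtain a b where ab: "p * e1 - (of_int a + of_int b * x) * e1 \<in> J" by blast
  have "\<exists>c. p * e2 - of_int c * e2 \<in> J"
  proof (induction p rule: generated)
    case 1
    then show ?case using mult[OF e, of 0] by (auto intro!: exI[of _ 0])
  next
    case (2 c p)
    then obtain d where d: "p * e2 - of_int d * e2 \<in> J" by blast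
    have "(of_int c + x * p) * e2 - of_int (c + d) * e2 \<in> J"
      by (rule comb2[OF d v, of _ x "of_int d"]) (simp add: algebra_simps)
    then show ?case by blast
  qed
  then obtain c where c: "p * e2 - of_int c * e2 \<in> J" by blast
  have "p - (of_int a * e1 + of_int b * (x * e1) + of_int c * e2) \<in> J"
    by (rule comb3[OF e ab c, of _ p 1 1]) (simp add: algebra_simps)
  moreover have "of_int a * e1 + of_int b * (x * e1) + of_int c * e2 \<in> M"
    by (intro plus scale S)
  ultimately show "p \<in> M"
    using J by blast
qed

text \<open>The orders of \<open>e1\<close> and \<open>e2\<close> are coprime, so their sum
  generates both.\<close>

lemma spans_two:
  assumes e: "1 - (e1 + e2) \<in> J" "(x\<^sup>2 + x - 1) * e1 \<in> J" "(x - 1) * e2 \<in> J"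
    and "3 * e2 \<in> J" and N: "of_int N * e1 \<in> J" "\<not> 3 dvd N"
  shows "spans_modulo J {e1 + e2, x * e1}"
proof (rule spans_modulo_trans[OF spans_three[OF e]])
  obtain k where k: "e2 - of_int k * (e1 + e2) \<in> J"
    using merge_coprime_orders[OF N \<open>3 * e2 \<in> J\<close>] by blast
  fix M s
  assume "{e1 + e2, x * e1} \<subseteq> M" and s: "s \<in> {e1, x * e1, e2}"
    and plus: "\<And>p q. p \<in> M \<Longrightarrow> q \<in> M \<Longrightarrow> p + q \<in> M"
    and scale: "\<And>k p. p \<in> M \<Longrightarrow> of_int k * p \<in> M"
    and J: "\<And>p q. q \<in> M \<Longrightarrow> p - q \<in> J \<Longrightarrow> p \<in> M"
  then have T: "e1 + e2 \<in> M" "x * e1 \<in> M" by auto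
  have e2: "e2 \<in> M"
    using J[OF scale k] T by blast
  then have "(e1 + e2) + of_int (-1) * e2 \<in> M"
    using T plus scale by blast
  then show "s \<in> M"
    using e2 T s by auto
qed

text \<open>With \<open>r a + s b = 1\<close> the vector \<open>(-s, r)\<close> completes the relation \<open>(a, b)\<close> to a basis of \<open>\<int>\<^sup>2\<close>, so it
  generates the summand of \<open>e1\<close>.\<close>

lemma spans_one:
  assumes e: "1 - (e1 + e2) \<in> J" "(x\<^sup>2 + x - 1) * e1 \<in> J" "(x - 1) * e2 \<in> J"
    and "3 * e2 \<in> J" and v: "(of_int a + of_int b * x) * e1 \<in> J" and "coprime a b"
    and N: "\<not> 3 dvd a\<^sup>2 - a * b - b\<^sup>2"
  shows "\<exists>g. spans_modulo J {g}"
proof -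
  obtain r s where rs: "r * a + s * b = 1"
    using \<open>coprime a b\<close> by (metis bezout_int coprime_imp_gcd_eq_1)
  have rs': "1 = of_int r * of_int a + of_int s * (of_int b :: 'r)"
    by (metis of_int_1 of_int_add of_int_mult rs)
  define g where "g = (of_int r * x - of_int s) * e1"
  \<comment> \<open>Modulo the relation, \<open>e1\<close> and \<open>x * e1\<close> are the
    multiples of \<open>g\<close> by \<open>- b\<close> and \<open>a\<close>.\<close>
  have "e1 - of_int (- b) * g = 1 * e1 + of_int b * g" by simp
  also have "\<dots> = of_int r * ((of_int a + of_int b * x) * e1)"
    unfolding rs' g_def by (simp add: algebra_simps)
  finally have 1: "e1 - of_int (- b) * g \<in> J"
    using mult[OF v] by simp
  have "x * e1 - of_int a * g = 1 * (x * e1) - of_int a * g" by simp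
  also have "\<dots> = of_int s * ((of_int a + of_int b * x) * e1)"
    unfolding rs' g_def by (simp add: algebra_simps)
  finally have 2: "x * e1 - of_int a * g \<in> J"
    using mult[OF v] by simp
  \<comment> \<open>As a multiple of \<open>e1\<close>, the element \<open>g\<close> is killed by
    the norm, which is prime to 3. It can therefore be merged with \<open>e2\<close>.\<close>
  have "of_int (a\<^sup>2 - a * b - b\<^sup>2) * g \<in> J"
    unfolding g_def using mult[OF annihilator[OF e(2) v]] by (simp only: mult.left_commute)
  then obtain k where k: "e2 - of_int k * (g + e2) \<in> J"
    using merge_coprime_orders[OF _ N \<open>3 * e2 \<in> J\<close>] by blast
  have "spans_modulo J {g + e2}"
  proof (rule spans_modulo_trans[OF spans_three[OF e]])
    fix M t
    assume "{g + e2} \<subseteq> M" and t: "t \<in> {e1, x * e1, e2}"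
      and plus: "\<And>p q. p \<in> M \<Longrightarrow> q \<in> M \<Longrightarrow> p + q \<in> M"
      and scale: "\<And>k p. p \<in> M \<Longrightarrow> of_int k * p \<in> M"
      and J: "\<And>p q. q \<in> M \<Longrightarrow> p - q \<in> J \<Longrightarrow> p \<in> M"
    then have T: "g + e2 \<in> M" by auto
    have e2: "e2 \<in> M"
      using J[OF scale k] T by blast
    then have "(g + e2) + of_int (-1) * e2 \<in> M"
      using T plus scale by blast
    then have g: "g \<in> M" by simp
    show "t \<in> M"
      using t e2 J[OF scale[OF g] 1] J[OF scale[OF g] 2] by auto
  qed
  then show ?thesis by blast
qed

lemma spanning_set_3: "\<exists>S. finite S \<and> card S \<le> 3 \<and> spans_modulo J S"
proof -
  obtain e1 e2 where "spans_modulo J {e1, x * e1, e2}"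
    using splitting spans_three by metis
  then show ?thesis
    by (intro exI[of _ "{e1, x * e1, e2}"]) (simp add: card_insert_if)
qed

lemma spanning_set_2:
  assumes "m mod 8 \<noteq> 4"
  shows "\<exists>S. finite S \<and> card S \<le> 2 \<and> spans_modulo J S"
proof -
  obtain e1 e2 where e: "1 - (e1 + e2) \<in> J" "(x\<^sup>2 + x - 1) * e1 \<in> J" "(x - 1) * e2 \<in> J" "3 * e2 \<in> J"
    and v: "(of_int (1 + nfib m + nfib (Suc m)) + of_int (nfib m) * x) * e1 \<in> J"
    using splitting by metis
  then have "spans_modulo J {e1 + e2, x * e1}"
    using spans_two[OF e annihilator[OF e(2) v] nfib_norm_not_dvd_3[OF assms refl refl]] by blast
  then show ?thesis
    by (intro exI[of _ "{e1 + e2, x * e1}"]) (simp add: card_insert_if)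
qed

lemma spanning_set_1:
  assumes "odd m"
  shows "\<exists>S. finite S \<and> card S \<le> 1 \<and> spans_modulo J S"
proof -
  obtain e1 e2 where e: "1 - (e1 + e2) \<in> J" "(x\<^sup>2 + x - 1) * e1 \<in> J" "(x - 1) * e2 \<in> J" "3 * e2 \<in> J"
    and v: "(of_int (1 + nfib m + nfib (Suc m)) + of_int (nfib m) * x) * e1 \<in> J"
    using splitting by metis
  have "m mod 8 \<noteq> 4"
    using assms by presburger
  then obtain g where "spans_modulo J {g}"
    using spans_one[OF e v coprime_nfib[OF assms m(2)] nfib_norm_not_dvd_3[OF _ refl refl]] by blast
  then show ?thesis
    by (intro exI[of _ "{g}"]) simp
qed

end

section \<open>Homomorphisms from presented groups\<close>

lemma min_generators_eqI:
  assumes "S \<subseteq> carrier G" "finite S" "card S \<le> d" "generate G S = carrier G"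
    and "\<And>T. T \<subseteq> carrier G \<Longrightarrow> finite T \<Longrightarrow> generate G T = carrier G \<Longrightarrow> d \<le> card T"
  shows "min_generators G = d"
  unfolding min_generators_def
proof (rule Least_equality)
  have "card S = d" using assms by (meson le_antisym)
  with assms show "\<exists>S\<subseteq>carrier G. finite S \<and> card S = d \<and> generate G S = carrier G" by blast
qed (use assms(5) in blast)

section \<open>Evaluating words and the universal properties\<close>

definition (in monoid) word_value :: "('i \<Rightarrow> 'a) \<Rightarrow> 'i letter list \<Rightarrow> 'a" where
  "word_value b w = foldr (\<lambda>(i, e) y. (if e then b i else inv b i) \<otimes> y) w \<one>"

context group
begin

lemma word_value_simps [simp]:
  "word_value b [] = \<one>"
  "word_value b (c # w) = (if snd c then b (fst c) else inv b (fst c)) \<otimes> word_value b w"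
  by (simp_all add: word_value_def split: prod.split)

lemma word_value_closed:
  "b \<in> S \<rightarrow> carrier G \<Longrightarrow> set w \<subseteq> S \<times> UNIV \<Longrightarrow> word_value b w \<in> carrier G"
  by (induction w) (auto simp: Pi_iff)

lemma word_value_cons_reduce:
  assumes "b \<in> S \<rightarrow> carrier G" "fst c \<in> S" "set w \<subseteq> S \<times> UNIV"
  shows "word_value b (cons_reduce c w) = word_value b (c # w)"
proof (cases w)
  case (Cons d v)
  have "b (fst c) \<in> carrier G" "word_value b v \<in> carrier G"
    using assms Cons word_value_closed[of b S v] by auto
  then show ?thesis
    using Cons by (auto simp: inv_letter_def simp flip: m_assoc)
qed simp

lemma word_value_foldr:
  assumes b: "b \<in> S \<rightarrow> carrier G" and "set u \<subseteq> S \<times> UNIV" "set v \<subseteq> S \<times> UNIV"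
  shows "word_value b (foldr cons_reduce u v) = word_value b u \<otimes> word_value b v"
  using assms(2)
proof (induction u)
  case Nil
  then show ?case using word_value_closed[OF b assms(3)] by simp
next
  case (Cons c u)
  have c: "fst c \<in> S" and u: "set u \<subseteq> S \<times> UNIV" using Cons.prems by auto
  then have "word_value b u \<in> carrier G" "word_value b v \<in> carrier G" "b (fst c) \<in> carrier G"
    using word_value_closed[OF b] assms(3) b by auto
  moreover have "set (foldr cons_reduce u v) \<subseteq> S \<times> UNIV"
    using set_foldr_cons_reduce[of u v] u assms(3) by blast
  ultimately show ?case
    using word_value_cons_reduce[OF b c] Cons u by (simp add: m_assoc)
qed

lemma word_value_hom:
  "b \<in> S \<rightarrow> carrier G \<Longrightarrow> word_value b \<in> hom (free_group S) G"
  by (rule homI) (auto simp: free_group_def word_value_closed word_value_foldr)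

end

lemma free_gen_closed: "i \<in> S \<Longrightarrow> free_gen i \<in> carrier (free_group S)"
  by (simp add: free_gen_def free_group_def reduced_def)

lemma generate_free_gen: "generate (free_group S) (free_gen ` S) = carrier (free_group S)"
proof
  interpret F: group "free_group S" by (rule free_group_is_group)
  show "generate (free_group S) (free_gen ` S) \<subseteq> carrier (free_group S)"
    by (rule F.generate_incl) (auto intro: free_gen_closed)
  show "carrier (free_group S) \<subseteq> generate (free_group S) (free_gen ` S)"
  proof
    fix w assume "w \<in> carrier (free_group S)"
    then have "reduced w" "set w \<subseteq> S \<times> UNIV" by (auto simp: free_group_def)
    then show "w \<in> generate (free_group S) (free_gen ` S)"
    proof (induction w)
      case Nil
      then show ?case
        using generate.one[of "free_group S"] by (simp add: free_group_def)
    next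
      case (Cons c w)
      have c: "fst c \<in> S" using Cons.prems by auto
      have gen: "[c] \<in> generate (free_group S) (free_gen ` S)"
      proof (cases "snd c")
        case True
        then have "[c] = free_gen (fst c)" by (simp add: free_gen_def prod_eq_iff)
        then show ?thesis using c by (simp add: generate.incl)
      next
        case False
        have "[c] \<otimes>\<^bsub>free_group S\<^esub> free_gen (fst c) = \<one>\<^bsub>free_group S\<^esub>" "[c] \<in> carrier (free_group S)"
          using False c by (auto simp: free_group_def free_gen_def reduced_def inv_letter_def prod_eq_iff mem_Times_iff)
        then have "[c] = inv\<^bsub>free_group S\<^esub> free_gen (fst c)"
          using F.inv_equality free_gen_closed[OF c] by metis
        then show ?thesis using c by (simp add: generate.inv)
      qed
      have eq: "[c] \<otimes>\<^bsub>free_group S\<^esub> w = c # w"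
        using cons_reduce_reduced[OF Cons.prems(1)] by (simp add: free_group_def)
      have "w \<in> generate (free_group S) (free_gen ` S)"
        using Cons.IH Cons.prems reduced_ConsD[OF Cons.prems(1)] by simp
      from generate.eng[OF gen this] show ?case unfolding eq .
    qed
  qed
qed

text \<open>Evaluation kills the relators, hence their normal closure, and its target is
  commutative. It therefore descends through both quotients; this serves the lower bounds.\<close>

lemma (in comm_group) presented_abelianization_hom:
  assumes b: "b \<in> S \<rightarrow> carrier G" and R: "R \<subseteq> carrier (free_group S)"
    and rel: "\<And>r. r \<in> R \<Longrightarrow> word_value b r = \<one>"
  obtains h where "h \<in> hom (abelianization (presented_group S R)) G"
    "generate G (b ` S) \<subseteq> h ` carrier (abelianization (presented_group S R))"
proof -
  let ?F = "free_group S" and ?P = "presented_group S R"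
  let ?N = "normal_closure ?F R" and ?D = "derived ?P (carrier ?P)"
  interpret F: group ?F by (rule free_group_is_group)
  interpret P: group ?P by (rule presented_group_is_group[OF R])
  interpret FG: group_hom ?F G "word_value b"
    by unfold_locales (rule word_value_hom[OF b])
  have N: "?N \<lhd> ?F" by (rule F.normal_closure_normal[OF R])
  have "?N \<subseteq> kernel ?F G (word_value b)"
    unfolding normal_closure_def
  proof (rule F.generate_subgroup_incl[OF _ FG.subgroup_kernel], clarify)
    fix g r assume "g \<in> carrier ?F" "r \<in> R"
    with R rel show "g \<otimes>\<^bsub>?F\<^esub> r \<otimes>\<^bsub>?F\<^esub> inv\<^bsub>?F\<^esub> g \<in> kernel ?F G (word_value b)"
      by (auto simp: kernel_def subset_iff)
  qed
  then obtain g where g: "g \<in> hom ?P G" "\<And>w. w \<in> carrier ?F \<Longrightarrow> g (?N #>\<^bsub>?F\<^esub> w) = word_value b w"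
    using FG.FactGroup_universal_kernel[OF N] unfolding presented_group_def by metis
  interpret PG: group_hom ?P G g
    by unfold_locales (rule g)
  have D: "?D \<lhd> ?P" by (rule P.derived_is_normal) (simp add: P.normal_self)
  have "g ` ?D = derived G (g ` carrier ?P)"
    using PG.derived_img[of "carrier ?P"] by simp
  also have "\<dots> = {\<one>}"
    by (rule derived_eq_singleton) auto
  finally have "?D \<subseteq> kernel ?P G g"
    using P.derived_in_carrier[of "carrier ?P"] by (auto simp: kernel_def)
  then obtain h where h: "h \<in> hom (abelianization ?P) G"
    "\<And>y. y \<in> carrier ?P \<Longrightarrow> h (?D #>\<^bsub>?P\<^esub> y) = g y"
    using PG.FactGroup_universal_kernel[OF D] unfolding abelianization_def by metis
  interpret A: group "abelianization ?P"
    unfolding abelianization_def by (rule P.derived_quot_is_group)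
  interpret AG: group_hom "abelianization ?P" G h
    by unfold_locales (rule h)
  have "b i \<in> h ` carrier (abelianization ?P)" if i: "i \<in> S" for i
  proof -
    have "?N #>\<^bsub>?F\<^esub> free_gen i \<in> carrier ?P"
      unfolding presented_group_def using free_gen_closed[OF i] by (auto simp: carrier_FactGroup)
    moreover from this have "?D #>\<^bsub>?P\<^esub> (?N #>\<^bsub>?F\<^esub> free_gen i) \<in> carrier (abelianization ?P)"
      by (auto simp: abelianization_def carrier_FactGroup)
    moreover have "word_value b (free_gen i) = b i"
      using b i by (auto simp: free_gen_def Pi_iff)
    ultimately show ?thesis
      using h(2) g(2)[OF free_gen_closed[OF i]] by (metis image_eqI)
  qed
  then have "generate G (b ` S) \<subseteq> h ` carrier (abelianization ?P)"
    by (intro generate_subgroup_incl AG.img_is_subgroup) auto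
  then show thesis using that h(1) by blast
qed

text \<open>\<open>p\<close> is the composite of the two quotient maps, hence onto, so the images of
  the free generators generate. This serves the upper bounds.\<close>

lemma abelianization_generators:
  assumes R: "R \<subseteq> carrier (free_group S)"
  obtains p where "p \<in> hom (free_group S) (abelianization (presented_group S R))"
    "\<And>r. r \<in> R \<Longrightarrow> p r = \<one>\<^bsub>abelianization (presented_group S R)\<^esub>"
    "generate (abelianization (presented_group S R)) ((\<lambda>i. p (free_gen i)) ` S) = carrier (abelianization (presented_group S R))"
proof -
  let ?F = "free_group S" and ?P = "presented_group S R" and ?A = "abelianization (presented_group S R)"
  let ?N = "normal_closure ?F R" and ?D = "derived ?P (carrier ?P)"
  interpret F: group ?F by (rule free_group_is_group)
  interpret P: group ?P by (rule presented_group_is_group[OF R])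
  interpret A: group ?A
    unfolding abelianization_def by (rule P.derived_quot_is_group)
  interpret N: normal ?N ?F by (rule F.normal_closure_normal[OF R])
  interpret D: normal ?D ?P by (rule P.derived_is_normal) (simp add: P.normal_self)
  define p where "p = (\<lambda>w. ?D #>\<^bsub>?P\<^esub> (?N #>\<^bsub>?F\<^esub> w))"
  have hN: "(\<lambda>w. ?N #>\<^bsub>?F\<^esub> w) \<in> hom ?F ?P"
    unfolding presented_group_def by (rule N.r_coset_hom_Mod)
  have hD: "(\<lambda>y. ?D #>\<^bsub>?P\<^esub> y) \<in> hom ?P ?A"
    unfolding abelianization_def by (rule D.r_coset_hom_Mod)
  have p: "p \<in> hom ?F ?A"
    using Group.hom_compose[OF hN hD] by (simp add: p_def comp_def)
  interpret pA: group_hom ?F ?A p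
    by unfold_locales (rule p)
  have "p r = \<one>\<^bsub>?A\<^esub>" if "r \<in> R" for r
  proof -
    have "r \<in> ?N"
    proof -
      have "\<one>\<^bsub>?F\<^esub> \<otimes>\<^bsub>?F\<^esub> r \<otimes>\<^bsub>?F\<^esub> inv\<^bsub>?F\<^esub> \<one>\<^bsub>?F\<^esub> = r" using R that by auto
      then show ?thesis unfolding normal_closure_def
        using that by (intro generate.incl) (metis (mono_tags, lifting) F.one_closed mem_Collect_eq)
    qed
    then have "?N #>\<^bsub>?F\<^esub> r = ?N"
      using R that by (intro F.coset_join2 N.is_subgroup) auto
    then have "?N #>\<^bsub>?F\<^esub> r = \<one>\<^bsub>?P\<^esub>" by (simp add: presented_group_def)
    then show ?thesis
      using hom_one[OF hD P.group_axioms A.group_axioms] by (simp add: p_def)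
  qed
  moreover have "carrier ?A \<subseteq> p ` carrier ?F"
  proof
    fix z assume "z \<in> carrier ?A"
    then obtain y where y: "y \<in> carrier ?P" "z = ?D #>\<^bsub>?P\<^esub> y"
      by (auto simp: abelianization_def carrier_FactGroup)
    moreover from y(1) obtain w where "w \<in> carrier ?F" "y = ?N #>\<^bsub>?F\<^esub> w"
      unfolding presented_group_def by (auto simp: carrier_FactGroup)
    ultimately show "z \<in> p ` carrier ?F" by (auto simp: p_def)
  qed
  then have "p ` carrier ?F = carrier ?A" by auto
  then have "generate ?A (p ` free_gen ` S) = carrier ?A"
    using pA.generate_img[of "free_gen ` S"] by (simp add: generate_free_gen free_gen_closed image_subset_iff)
  then have "generate ?A ((\<lambda>i. p (free_gen i)) ` S) = carrier ?A"
    by (simp add: image_image)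
  ultimately show thesis using that p by blast
qed

text \<open>Peeling off one generator \<open>s\<close>, every element is \<open>s^i * g\<close> with
  \<open>i < n\<close> and \<open>g\<close> generated by the others.\<close>

lemma (in group) card_generate_le_exponent:
  assumes "comm_group G" "finite S" "S \<subseteq> carrier G" "n > 0"
    and "\<And>g. g \<in> carrier G \<Longrightarrow> g [^] (n :: nat) = \<one>"
  shows "finite (generate G S) \<and> card (generate G S) \<le> n ^ card S"
  using assms(2,3)
proof (induction S rule: finite_induct)
  case empty
  then show ?case by (simp add: generate_empty)
next
  case (insert s S)
  interpret comm_group G by fact
  have s: "s \<in> carrier G" and S: "S \<subseteq> carrier G" using insert by auto
  let ?f = "\<lambda>(i, g). s [^] (i::nat) \<otimes> g"
  have sub: "generate G (insert s S) \<subseteq> ?f ` ({..<n} \<times> generate G S)"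
  proof
    fix y assume "y \<in> generate G (insert s S)"
    then have "\<exists>i::int. \<exists>g\<in>generate G S. y = s [^] i \<otimes> g"
    proof (induction rule: generate.induct)
      case one
      show ?case by (intro exI[of _ 0] bexI[of _ \<one>]) (auto intro: generate.one)
    next
      case (incl h)
      then show ?case
      proof (cases "h = s")
        case True
        then show ?thesis using s by (intro exI[of _ 1] bexI[of _ \<one>]) (auto intro: generate.one)
      next
        case False
        then show ?thesis using incl S by (intro exI[of _ 0] bexI[of _ h]) (auto intro: generate.incl)
      qed
    next
      case (inv h)
      then show ?case
      proof (cases "h = s")
        case True
        then show ?thesis using s
          by (intro exI[of _ "-1"] bexI[of _ \<one>]) (auto intro: generate.one simp: int_pow_neg)
      next
        case False
        then show ?thesis using inv S by (intro exI[of _ 0] bexI[of _ "inv h"]) (auto intro: generate.inv)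
      qed
    next
      case (eng h1 h2)
      from eng.IH(1) obtain i :: int and g where 1: "g \<in> generate G S" "h1 = s [^] i \<otimes> g" by blast
      from eng.IH(2) obtain j :: int and g' where 2: "g' \<in> generate G S" "h2 = s [^] j \<otimes> g'" by blast
      have ij: "g \<in> generate G S" "g' \<in> generate G S" using 1 2 by auto
      then have "g \<in> carrier G" "g' \<in> carrier G"
        using generate_in_carrier[OF S] by auto
      then have "h1 \<otimes> h2 = s [^] (i + j) \<otimes> (g \<otimes> g')"
        using s 1(2) 2(2) by (simp add: int_pow_mult m_ac)
      then show ?case using generate.eng[OF ij] by (intro exI bexI)
    qed
    then obtain i :: int and g where ig: "g \<in> generate G S" "y = s [^] i \<otimes> g" by blast
    \<comment> \<open>Integer exponents absorbed the inverses; division by \<open>n\<close> brings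
      them into \<open>{..<n}\<close>.\<close>
    have "s [^] i = s [^] (int n * (i div int n) + i mod int n)" by simp
    also have "\<dots> = s [^] (int n * (i div int n)) \<otimes> s [^] (i mod int n)"
      using s by (rule int_pow_mult)
    also have "s [^] (int n * (i div int n)) = (s [^] int n) [^] (i div int n)"
      using s by (rule int_pow_pow[symmetric])
    also have "s [^] int n = \<one>"
      using assms(5)[OF s] by (simp add: int_pow_int)
    also have "s [^] (i mod int n) = s [^] nat (i mod int n)"
      using assms(4) by (simp flip: int_pow_int)
    finally have "s [^] i = s [^] nat (i mod int n)" using s by simp
    moreover have "nat (i mod int n) < n" using assms(4) by (simp add: nat_less_iff)
    ultimately show "y \<in> ?f ` ({..<n} \<times> generate G S)"
      using ig by (intro image_eqI[of _ _ "(nat (i mod int n), g)"]) auto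
  qed
  have fin: "finite (generate G S)" "card (generate G S) \<le> n ^ card S"
    using insert S by auto
  then have fin': "finite (?f ` ({..<n} \<times> generate G S))" by simp
  have "card (generate G (insert s S)) \<le> card (?f ` ({..<n} \<times> generate G S))"
    by (rule card_mono[OF fin' sub])
  also have "\<dots> \<le> card ({..<n} \<times> generate G S)"
    using fin by (intro card_image_le) simp
  also have "\<dots> \<le> n ^ card (insert s S)"
    using fin insert(1,2) by (simp add: card_cartesian_product)
  finally show ?case
    using finite_subset[OF sub fin'] by simp
qed

section \<open>Abelian groups with cyclic relations\<close>

context comm_group
begin

text \<open>The homomorphism from the additive group of integer polynomials sending
  \<open>x^i\<close> to \<open>a i\<close>; multiplication by \<open>x\<close> becomes an index
  shift.\<close>

definition eval_poly :: "(nat \<Rightarrow> 'a) \<Rightarrow> int poly \<Rightarrow> 'a" where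
  "eval_poly a p = (\<Otimes>i\<in>{..degree p}. a i [^] coeff p i)"

context
  fixes a :: "nat \<Rightarrow> 'a"
  assumes a: "\<And>i. a i \<in> carrier G"
begin

lemma eval_poly_upto: "degree p \<le> N \<Longrightarrow> eval_poly a p = (\<Otimes>i\<in>{..N}. a i [^] coeff p i)"
  unfolding eval_poly_def
  by (rule finprod_mono_neutral_cong_left) (auto simp: a coeff_eq_0)

lemma eval_poly_closed: "eval_poly a p \<in> carrier G"
  unfolding eval_poly_def by (rule finprod_closed) (auto simp: a)

lemma eval_poly_add: "eval_poly a (p + q) = eval_poly a p \<otimes> eval_poly a q"
proof -
  let ?N = "max (degree p) (degree q)"
  have "eval_poly a (p + q) = (\<Otimes>i\<in>{..?N}. a i [^] coeff p i \<otimes> a i [^] coeff q i)"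
    by (subst eval_poly_upto[of _ ?N]) (simp_all add: degree_add_le_max int_pow_mult a)
  also have "\<dots> = (\<Otimes>i\<in>{..?N}. a i [^] coeff p i) \<otimes> (\<Otimes>i\<in>{..?N}. a i [^] coeff q i)"
    by (rule finprod_multf) (auto simp: a)
  finally show ?thesis
    by (simp add: eval_poly_upto[of p ?N] eval_poly_upto[of q ?N])
qed

lemma eval_poly_diff: "eval_poly a (p - q) = eval_poly a p \<otimes> inv eval_poly a q"
  using eval_poly_add[of "p - q" q] eval_poly_closed[of p] eval_poly_closed[of q]
    eval_poly_closed[of "p - q"] inv_solve_right by simp

lemma eval_poly_monom: "eval_poly a (monom c i) = a i [^] c"
proof -
  have "eval_poly a (monom c i) = (\<Otimes>j\<in>{..i}. if i = j then a j [^] c else \<one>)"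
    by (subst eval_poly_upto[of _ i]) (auto simp: degree_monom_le a intro!: finprod_cong')
  also have "\<dots> = a i [^] c"
    by (rule finprod_singleton) (auto simp: a)
  finally show ?thesis .
qed

lemma eval_poly_0: "eval_poly a 0 = \<one>"
  using eval_poly_monom[of 0 0] by (simp add: a)

text \<open>Quantifying over all multiples makes this an ideal outright.\<close>

definition eval_ideal :: "int poly set" where
  "eval_ideal = {p. \<forall>q. eval_poly a (q * p) = \<one>}"

lemma eval_idealI:
  assumes "\<And>i. eval_poly a (monom 1 i * p) = \<one>"
  shows "p \<in> eval_ideal"
proof -
  let ?K = "{p. eval_poly a p = \<one>}"
  have scale: "of_int k * p \<in> ?K" if "p \<in> ?K" for k p
    by (rule of_int_mult_closed[OF _ that]) (simp add: eval_poly_diff)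
  \<comment> \<open>Generalizing over \<open>i\<close> lets the factor \<open>x\<close> from
    \<open>pCons\<close> be absorbed into the shift.\<close>
  have "eval_poly a (monom 1 i * q * p) = \<one>" for i q
  proof (induction q arbitrary: i)
    case 0
    then show ?case by (simp add: eval_poly_0)
  next
    case (pCons c q)
    have "pCons c q = of_int c + monom 1 1 * q"
      by (simp add: of_int_poly monom_altdef)
    then have "monom 1 i * pCons c q * p = of_int c * (monom 1 i * p) + (monom 1 i * monom 1 1) * q * p"
      by (simp add: algebra_simps)
    also have "monom 1 i * monom 1 1 = (monom 1 (Suc i) :: int poly)"
      by (simp add: mult_monom)
    finally show ?case
      using pCons.IH[of "Suc i"] scale[of "monom 1 i * p" c] assms by (simp add: eval_poly_add)
  qed
  from this[of 0] show ?thesis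
    by (simp add: eval_ideal_def monom_0 flip: one_pCons)
qed

lemma generated_relation_ideal_eval:
  assumes periodic: "\<And>i. a (i + 2 * m) = a i"
    and relation: "\<And>i. a i \<otimes> a (i + 1) \<otimes> a (i + (m - 1)) = \<one>"
    and m: "m \<ge> 1" "\<not> 3 dvd m"
  shows "generated_relation_ideal eval_ideal [:0, 1:] m"
proof
  have X: "[:0, 1:] ^ k = (monom 1 k :: int poly)" for k
    by (simp add: monom_altdef)
  show "[:0, 1:] ^ (2 * m) - 1 \<in> eval_ideal"
  proof (rule eval_idealI)
    fix i
    have "monom 1 i * ([:0, 1:] ^ (2 * m) - 1) = monom 1 (i + 2 * m) - (monom 1 i :: int poly)"
      unfolding X by (simp add: right_diff_distrib mult_monom)
    then show "eval_poly a (monom 1 i * ([:0, 1:] ^ (2 * m) - 1)) = \<one>"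
      by (simp add: eval_poly_diff eval_poly_monom a periodic)
  qed
  show "1 + [:0, 1:] + [:0, 1:] ^ (m - 1) \<in> eval_ideal"
  proof (rule eval_idealI)
    fix i
    have "monom 1 i * (1 + [:0, 1:] + [:0, 1:] ^ (m - 1))
        = monom 1 i + monom 1 (i + 1) + (monom 1 (i + (m - 1)) :: int poly)"
      unfolding X using X[of 1] by (simp add: distrib_left mult_monom)
    then show "eval_poly a (monom 1 i * (1 + [:0, 1:] + [:0, 1:] ^ (m - 1))) = \<one>"
      using relation[of i] by (simp add: eval_poly_add eval_poly_monom a)
  qed
  fix p q
  assume p: "p \<in> eval_ideal"
  show "q * p \<in> eval_ideal"
    using p by (simp add: eval_ideal_def flip: mult.assoc)
  assume "q \<in> eval_ideal"
  with p show "p + q \<in> eval_ideal"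
    by (simp add: eval_ideal_def distrib_left eval_poly_add)
next
  fix P :: "int poly \<Rightarrow> bool" and p
  assume P: "P 0" "\<And>c p. P p \<Longrightarrow> P (of_int c + [:0, 1:] * p)"
  show "P p"
  proof (induction p)
    case (pCons c p)
    then show ?case using P(2)[of p c] by (simp add: of_int_poly)
  qed (rule P(1))
qed (use m in auto)

lemma generate_eval_poly:
  assumes gen: "generate G (range a) = carrier G" and S: "spans_modulo eval_ideal S"
  shows "generate G (eval_poly a ` S) = carrier G"
proof
  let ?H = "generate G (eval_poly a ` S)"
  have H: "subgroup ?H G"
    by (rule generate_is_subgroup) (auto simp: eval_poly_closed)
  show "?H \<subseteq> carrier G"
    using H by (rule subgroup.subset)
  \<comment> \<open>The preimage of \<open>?H\<close> is the subgroup to which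
    \<open>spans_modulo\<close> applies.\<close>
  have "{p. eval_poly a p \<in> ?H} = UNIV"
  proof (rule S[unfolded spans_modulo_def, rule_format])
    show "eval_ideal \<subseteq> {p. eval_poly a p \<in> ?H}"
    proof
      fix p assume "p \<in> eval_ideal"
      then have "eval_poly a (1 * p) = \<one>" unfolding eval_ideal_def by blast
      then show "p \<in> {p. eval_poly a p \<in> ?H}" by (simp add: generate.one)
    qed
    show "S \<subseteq> {p. eval_poly a p \<in> ?H}"
      by (auto intro: generate.incl)
    show "p - q \<in> {p. eval_poly a p \<in> ?H}"
      if "p \<in> {p. eval_poly a p \<in> ?H}" "q \<in> {p. eval_poly a p \<in> ?H}" for p q
      using that H by (auto simp: eval_poly_diff intro: subgroup.m_closed subgroup.m_inv_closed)
  qed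
  then have "a i \<in> ?H" for i
    using eval_poly_monom[of 1 i] a[of i] by (metis UNIV_I int_pow_1 mem_Collect_eq)
  then show "carrier G \<subseteq> ?H"
    using generate_subgroup_incl[OF _ H, of "range a"] gen by blast
qed

end

lemma small_generating_set:
  fixes a :: "nat \<Rightarrow> 'a"
  assumes a: "\<And>i. a i \<in> carrier G" and gen: "generate G (range a) = carrier G"
    and "\<And>i. a (i + 2 * m) = a i" "\<And>i. a i \<otimes> a (i + 1) \<otimes> a (i + (m - 1)) = \<one>"
    and "m \<ge> 1" "\<not> 3 dvd m"
    and d: "d = 3 \<or> d = 2 \<and> m mod 8 \<noteq> 4 \<or> d = 1 \<and> odd m"
  shows "\<exists>T\<subseteq>carrier G. finite T \<and> card T \<le> d \<and> generate G T = carrier G"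
proof -
  interpret generated_relation_ideal "eval_ideal a" "[:0, 1:]" m
    by (rule generated_relation_ideal_eval) fact+
  obtain S where S: "finite S" "card S \<le> d" "spans_modulo (eval_ideal a) S"
    using d spanning_set_1 spanning_set_2 spanning_set_3 by blast
  show ?thesis
  proof (intro exI conjI)
    show "eval_poly a ` S \<subseteq> carrier G" using eval_poly_closed[of a, OF a] by blast
    show "finite (eval_poly a ` S)" using S by simp
    show "card (eval_poly a ` S) \<le> d" using card_image_le[OF S(1)] S(2) le_trans by blast
    show "generate G (eval_poly a ` S) = carrier G" by (rule generate_eval_poly[of a, OF a gen S(3)])
  qed
qed

end

section \<open>Fibonacci quotients\<close>

definition nfib_target :: "nat \<Rightarrow> nat \<Rightarrow> (int \<times> int \<times> int) monoid" where
  "nfib_target c N = integer_mod_group c \<times>\<times> (integer_mod_group N \<times>\<times> integer_mod_group N)"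

text \<open>The image of \<open>x^i\<close>: first in the factor where \<open>x = 1\<close>, which
  \<open>c = 1\<close> suppresses, then modulo \<open>x^2 + x - 1\<close> and \<open>N\<close> in
  the basis \<open>x + 1, 1\<close>.\<close>

definition nfib_vec :: "nat \<Rightarrow> nat \<Rightarrow> nat \<Rightarrow> int \<times> int \<times> int" where
  "nfib_vec c N i = (1 mod int c, nfib i mod int N, nfib (Suc i) mod int N)"

lemma nfib_target_simps:
  assumes "c > 0" "N > 0"
  shows "carrier (nfib_target c N) = {0..<int c} \<times> {0..<int N} \<times> {0..<int N}"
    "\<one>\<^bsub>nfib_target c N\<^esub> = (0, 0, 0)"
    "(p, q, r) \<otimes>\<^bsub>nfib_target c N\<^esub> (p', q', r') = ((p + p') mod int c, (q + q') mod int N, (r + r') mod int N)"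
  using assms by (simp_all add: nfib_target_def carrier_integer_mod_group)

lemma nfib_target_comm_group:
  assumes "c > 0" "N > 0"
  shows "comm_group (nfib_target c N)"
proof (rule group.group_comm_groupI)
  show "group (nfib_target c N)"
    unfolding nfib_target_def by (intro DirProd_group group_integer_mod_group)
qed (auto simp: nfib_target_simps[OF assms] add.commute)

lemma nfib_target_pow:
  assumes "c > 0" "N > 0" "(p, q, r) \<in> carrier (nfib_target c N)"
  shows "(p, q, r) [^]\<^bsub>nfib_target c N\<^esub> (k :: nat) = (int k * p mod int c, int k * q mod int N, int k * r mod int N)"
proof -
  interpret comm_group "nfib_target c N" by (rule nfib_target_comm_group[OF assms(1,2)])
  show ?thesis
    by (induction k) (simp_all add: nfib_target_simps[OF assms(1,2)] mod_simps algebra_simps)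
qed

text \<open>The vectors at positions 0, 1, 2 form a matrix of determinant \<open>-1\<close>.\<close>

lemma generate_nfib_vec:
  assumes cN: "c > 0" "N > 0" and E: "E > 0" "c dvd E" "N dvd E"
  shows "carrier (nfib_target c N) \<subseteq> generate (nfib_target c N) (range (nfib_vec c N))"
proof
  let ?B = "nfib_target c N"
  let ?H = "generate ?B (range (nfib_vec c N))"
  interpret comm_group ?B by (rule nfib_target_comm_group[OF cN])
  have vec: "nfib_vec c N i \<in> carrier ?B" for i
    using cN by (auto simp: nfib_target_simps[OF cN] nfib_vec_def)
  have H: "subgroup ?H ?B"
    by (rule generate_is_subgroup) (auto simp: vec)
  have pow: "nfib_vec c N i [^]\<^bsub>?B\<^esub> (k :: nat) \<in> ?H" for i k
    by (induction k) (auto intro: generate.one generate.eng generate.incl)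
  fix y assume "y \<in> carrier ?B"
  then obtain s t u where y: "y = (s, t, u)" "0 \<le> s" "s < int c" "0 \<le> t" "t < int N" "0 \<le> u" "u < int N"
    by (auto simp: nfib_target_simps[OF cN])
  \<comment> \<open>The coefficients invert the integer matrix. Reduction modulo \<open>E\<close>
    makes them natural numbers without changing them modulo \<open>c\<close> or
    \<open>N\<close>.\<close>
  define k0 k1 k2 where "k0 = nat ((3 * t + 2 * u - s) mod int E)"
    and "k1 = nat ((s - t - u) mod int E)" and "k2 = nat ((s - 2 * t - u) mod int E)"
  have k: "int k0 = (3 * t + 2 * u - s) mod int E" "int k1 = (s - t - u) mod int E"
    "int k2 = (s - 2 * t - u) mod int E"
    using E by (simp_all add: k0_def k1_def k2_def)
  have k': "int k0 mod int d = (3 * t + 2 * u - s) mod int d" "int k1 mod int d = (s - t - u) mod int d"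
    "int k2 mod int d = (s - 2 * t - u) mod int d" if "d dvd E" for d
    unfolding k using that by (simp_all add: mod_mod_cancel)
  have "y = nfib_vec c N 0 [^]\<^bsub>?B\<^esub> k0 \<otimes>\<^bsub>?B\<^esub> nfib_vec c N 1 [^]\<^bsub>?B\<^esub> k1 \<otimes>\<^bsub>?B\<^esub> nfib_vec c N 2 [^]\<^bsub>?B\<^esub> k2"
  proof -
    have "(int k0 + int k1 + int k2) mod int c = s"
    proof -
      have "(int k0 + int k1 + int k2) mod int c = ((3 * t + 2 * u - s) + (s - t - u) + (s - 2 * t - u)) mod int c"
        by (intro mod_add_cong k' E)
      then show ?thesis using y by simp
    qed
    moreover have "(int k1 - int k2) mod int N = t"
    proof -
      have "(int k1 - int k2) mod int N = ((s - t - u) - (s - 2 * t - u)) mod int N"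
        by (intro mod_diff_cong k' E)
      then show ?thesis using y by simp
    qed
    moreover have "(int k0 - int k1 + 2 * int k2) mod int N = u"
    proof -
      have "(int k0 - int k1 + 2 * int k2) mod int N
          = ((3 * t + 2 * u - s) - (s - t - u) + 2 * (s - 2 * t - u)) mod int N"
        by (intro mod_diff_cong mod_add_cong mod_mult_cong k' E refl)
      then show ?thesis using y by simp
    qed
    moreover have "nfib 3 = 2" "nfib 2 = -1" by (simp_all add: nfib_numeral)
    ultimately show ?thesis
      using vec[of 0] vec[of 1] vec[of 2] unfolding nfib_vec_def y(1)
      by (simp add: nfib_target_pow[OF cN] nfib_target_simps[OF cN] mod_simps
          flip: numeral_2_eq_2 numeral_3_eq_3) (simp add: algebra_simps)
  qed
  also have "\<dots> \<in> ?H"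
    by (intro generate.eng pow)
  finally show "y \<in> ?H" .
qed

text \<open>The assumptions say that \<open>x^m = -1\<close> modulo \<open>N\<close> and
  \<open>x^2 + x - 1\<close>.\<close>

lemma nfib_shift:
  assumes "int N dvd nfib m" "int N dvd nfib (Suc m) + 1"
  shows "int N dvd nfib (i + m) + nfib i"
proof -
  have "nfib (i + m) + nfib i = nfib m * (nfib (Suc i) + nfib i) + nfib i * (nfib (Suc m) + 1)"
    using nfib_add[of i m] by (simp add: algebra_simps)
  then show ?thesis
    using assms by (simp add: dvd_add)
qed

lemma nfib_vec_periodic:
  assumes N: "int N dvd nfib m" "int N dvd nfib (Suc m) + 1"
  shows "nfib_vec c N (i mod (2 * m)) = nfib_vec c N i"
proof -
  have *: "nfib (i + 2 * m) mod int N = nfib i mod int N" for i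
  proof -
    have "int N dvd (nfib (i + m + m) + nfib (i + m)) - (nfib (i + m) + nfib i)"
      by (intro dvd_diff nfib_shift[OF N])
    then show ?thesis by (simp add: mod_eq_dvd_iff mult_2 add.assoc)
  qed
  have **: "nfib (r + k * (2 * m)) mod int N = nfib r mod int N" for r k
  proof (induction k)
    case (Suc k)
    then show ?case using *[of "r + k * (2 * m)"] by (simp add: algebra_simps)
  qed simp
  have "nfib_vec c N (i mod (2 * m) + i div (2 * m) * (2 * m)) = nfib_vec c N (i mod (2 * m))"
    using **[of "i mod (2 * m)" "i div (2 * m)"] **[of "Suc (i mod (2 * m))" "i div (2 * m)"]
    unfolding nfib_vec_def by simp
  then show ?thesis by (metis mod_div_mult_eq)
qed

lemma nfib_vec_relation:
  assumes cN: "c > 0" "N > 0" "c dvd 3" and N: "int N dvd nfib m" "int N dvd nfib (Suc m) + 1" and m: "m \<ge> 1"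
  shows "nfib_vec c N i \<otimes>\<^bsub>nfib_target c N\<^esub> (nfib_vec c N (i + 1)
     \<otimes>\<^bsub>nfib_target c N\<^esub> (nfib_vec c N (i + (m - 1)) \<otimes>\<^bsub>nfib_target c N\<^esub> \<one>\<^bsub>nfib_target c N\<^esub>)) = \<one>\<^bsub>nfib_target c N\<^esub>"
proof -
  have *: "(nfib i + (nfib (Suc i) + nfib (i + (m - 1)))) mod int N = 0" for i
  proof -
    obtain k where k: "m = Suc k" using m by (cases m) auto
    \<comment> \<open>The recurrence read backwards: \<open>nfib (i + (m - 1))\<close> is the sum of
      the next two values.\<close>
    have "nfib i + (nfib (Suc i) + nfib (i + (m - 1))) = (nfib (Suc i + m) + nfib (Suc i)) + (nfib (i + m) + nfib i)"
      unfolding k by simp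
    also have "\<dots> mod int N = 0"
      by (intro dvd_imp_mod_0 dvd_add nfib_shift[OF N])
    finally show ?thesis .
  qed
  have "int c dvd 3" using cN(3) by (metis int_dvd_int_iff of_nat_numeral)
  then show ?thesis
    using *[of i] *[of "Suc i"]
    by (simp add: nfib_vec_def nfib_target_simps[OF cN(1,2)] mod_simps del: nfib.simps(3))
qed

section \<open>The abelianization\<close>

definition cyclic_relator :: "nat \<Rightarrow> nat letter list" where
  "cyclic_relator m = [(0, True), (1, True), (m - 1, True)]"

lemma shift_cyclic_relator:
  "shift_word n i (cyclic_relator m) = [(i mod n, True), ((i + 1) mod n, True), ((i + (m - 1)) mod n, True)]"
  by (simp add: shift_word_def cyclic_relator_def)

text \<open>All letters are positive, so nothing cancels even if indices coincide.\<close>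

lemma free_group_mult_cyclic_relator:
  "free_gen 0 \<otimes>\<^bsub>free_group S\<^esub> free_gen 1 \<otimes>\<^bsub>free_group S\<^esub> free_gen (m - 1) = cyclic_relator m"
  by (simp add: free_group_def free_gen_def cyclic_relator_def inv_letter_def)

lemma cyclic_relators_closed:
  assumes "n = 2 * m" "m \<ge> 1"
  shows "{shift_word n i (cyclic_relator m) | i. i < n} \<subseteq> carrier (free_group {..<n})"
proof -
  have "cyclic_relator m \<in> carrier (free_group {..<n})"
    using assms by (auto simp: free_group_def cyclic_relator_def reduced_def inv_letter_def)
  then show ?thesis by (auto intro: shift_word_in_carrier)
qed

lemma abelianization_comm_group: "group P \<Longrightarrow> comm_group (abelianization P)"
  unfolding abelianization_def by (rule group.derived_quot_is_comm_group)

lemma cyclic_generating_set: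
  assumes n: "n = 2 * m" "m \<ge> 1" "\<not> 3 dvd m"
    and d: "d = 3 \<or> d = 2 \<and> m mod 8 \<noteq> 4 \<or> d = 1 \<and> odd m"
    and A: "A = abelianization (cyclically_presented_group n (cyclic_relator m))"
  shows "\<exists>T\<subseteq>carrier A. finite T \<and> card T \<le> d \<and> generate A T = carrier A"
proof -
  let ?F = "free_group {..<n}" and ?R = "{shift_word n i (cyclic_relator m) | i. i < n}"
  have R: "?R \<subseteq> carrier ?F" by (rule cyclic_relators_closed[OF n(1,2)])
  have A': "A = abelianization (presented_group {..<n} ?R)"
    unfolding A cyclically_presented_group_def ..
  interpret comm_group A
    unfolding A' by (intro abelianization_comm_group presented_group_is_group R)
  obtain p where p: "p \<in> hom ?F A" "\<And>r. r \<in> ?R \<Longrightarrow> p r = \<one>\<^bsub>A\<^esub>"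
    "generate A ((\<lambda>i. p (free_gen i)) ` {..<n}) = carrier A"
    unfolding A' using abelianization_generators[OF R] by blast
  interpret p: group_hom ?F A p
    by (intro group_hom.intro group_hom_axioms.intro free_group_is_group group_axioms p(1))
  \<comment> \<open>The generators are extended periodically to all indices, so that polynomials can
    be evaluated at them.\<close>
  define a where "a i = p (free_gen (i mod n))" for i
  have mod: "free_gen (i mod n) \<in> carrier ?F" for i
    using n by (intro free_gen_closed) simp
  have a: "a i \<in> carrier A" for i
    unfolding a_def by (rule hom_in_carrier[OF p(1) mod])
  have "range (\<lambda>i. i mod n) = {..<n}"
    using n by (auto simp: image_iff) (metis mod_less)
  moreover have "range a = (\<lambda>i. p (free_gen i)) ` range (\<lambda>i. i mod n)"
    by (simp add: a_def image_image)
  ultimately have gen: "generate A (range a) = carrier A" using p(3) by simp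
  have periodic: "a (i + 2 * m) = a i" for i
    by (simp add: a_def n)
  have relation: "a i \<otimes>\<^bsub>A\<^esub> a (i + 1) \<otimes>\<^bsub>A\<^esub> a (i + (m - 1)) = \<one>\<^bsub>A\<^esub>" for i
  proof -
    have "a i \<otimes>\<^bsub>A\<^esub> a (i + 1) \<otimes>\<^bsub>A\<^esub> a (i + (m - 1))
        = p (free_gen (i mod n) \<otimes>\<^bsub>?F\<^esub> free_gen ((i + 1) mod n) \<otimes>\<^bsub>?F\<^esub> free_gen ((i + (m - 1)) mod n))"
      unfolding a_def by (simp only: p.hom_mult p.m_closed mod)
    also have "free_gen (i mod n) \<otimes>\<^bsub>?F\<^esub> free_gen ((i + 1) mod n) \<otimes>\<^bsub>?F\<^esub> free_gen ((i + (m - 1)) mod n)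
        = shift_word n (i mod n) (cyclic_relator m)"
      unfolding shift_cyclic_relator by (simp add: free_group_def free_gen_def inv_letter_def mod_simps)
    also have "p \<dots> = \<one>\<^bsub>A\<^esub>"
    proof (rule p(2))
      have "i mod n < n" using n by simp
      then show "shift_word n (i mod n) (cyclic_relator m) \<in> ?R" by blast
    qed
    finally show ?thesis .
  qed
  show ?thesis
    by (rule small_generating_set[OF a gen periodic relation n(2,3) d])
qed

text \<open>\<open>A\<close> maps onto \<open>nfib_target c N\<close>, of order
  \<open>c * N^2\<close> and exponent dividing \<open>E\<close>. The image of \<open>T\<close>
  generates it, so counting bounds \<open>card T\<close> from below.\<close>

lemma cyclic_generating_set_card_ge:
  assumes n: "n = 2 * m" "m \<ge> 1"
    and cN: "c > 0" "N > 0" "c dvd 3" and E: "E > 0" "c dvd E" "N dvd E"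
    and N: "int N dvd nfib m" "int N dvd nfib (Suc m) + 1"
    and A: "A = abelianization (cyclically_presented_group n (cyclic_relator m))"
    and T: "T \<subseteq> carrier A" "finite T" "generate A T = carrier A"
  shows "c * N\<^sup>2 \<le> E ^ card T"
proof -
  let ?F = "free_group {..<n}" and ?R = "{shift_word n i (cyclic_relator m) | i. i < n}"
    and ?B = "nfib_target c N" and ?b = "nfib_vec c N"
  have R: "?R \<subseteq> carrier ?F" by (rule cyclic_relators_closed[OF n])
  have A': "A = abelianization (presented_group {..<n} ?R)"
    unfolding A cyclically_presented_group_def ..
  interpret A: comm_group A
    unfolding A' by (intro abelianization_comm_group presented_group_is_group R)
  interpret B: comm_group ?B by (rule nfib_target_comm_group[OF cN(1,2)])
  have b: "?b i \<in> carrier ?B" for i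
    using cN by (auto simp: nfib_target_simps[OF cN(1,2)] nfib_vec_def)
  have rel: "B.word_value ?b r = \<one>\<^bsub>?B\<^esub>" if r: "r \<in> ?R" for r
  proof -
    obtain i where "r = shift_word n i (cyclic_relator m)" using r by blast
    then show ?thesis
      using nfib_vec_relation[OF cN N n(2), of i]
      unfolding shift_cyclic_relator n(1) by (simp add: nfib_vec_periodic[OF N])
  qed
  have "?b \<in> {..<n} \<rightarrow> carrier ?B" using b by blast
  then obtain h where h: "h \<in> hom A ?B" "generate ?B (?b ` {..<n}) \<subseteq> h ` carrier A"
    unfolding A' using B.presented_abelianization_hom[OF _ R rel] by blast
  interpret h: group_hom A ?B h by unfold_locales (rule h)
  have "range ?b \<subseteq> ?b ` {..<n}"
  proof
    fix y assume "y \<in> range ?b"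
    then obtain i where "y = ?b i" by blast
    then have "y = ?b (i mod n)"
      unfolding n(1) by (simp only: nfib_vec_periodic[OF N])
    then show "y \<in> ?b ` {..<n}" using n by auto
  qed
  then have "carrier ?B \<subseteq> h ` carrier A"
    by (intro order_trans[OF generate_nfib_vec[OF cN(1,2) E] order_trans[OF B.mono_generate h(2)]])
  also have "h ` carrier A = generate ?B (h ` T)"
    using h.generate_img[OF T(1)] T(3) by simp
  finally have sub: "carrier ?B \<subseteq> generate ?B (h ` T)" .
  have "g [^]\<^bsub>?B\<^esub> E = \<one>\<^bsub>?B\<^esub>" if g: "g \<in> carrier ?B" for g
  proof -
    obtain q r s where "g = (q, r, s)" by (cases g)
    then show ?thesis
      using g E nfib_target_pow[OF cN(1,2), of q r s E] by (simp add: nfib_target_simps[OF cN(1,2)])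
  qed
  moreover have "h ` T \<subseteq> carrier ?B" using T(1) by auto
  ultimately have gen: "finite (generate ?B (h ` T))" "card (generate ?B (h ` T)) \<le> E ^ card (h ` T)"
    using B.card_generate_le_exponent[OF B.comm_group_axioms, of "h ` T" E] T(2) E(1) by simp_all
  have "c * N\<^sup>2 = card (carrier ?B)"
    by (simp add: nfib_target_simps[OF cN(1,2)] card_cartesian_product power2_eq_square)
  also have "\<dots> \<le> E ^ card (h ` T)"
    using card_mono[OF gen(1) sub] gen(2) by linarith
  also have "\<dots> \<le> E ^ card T"
    using E(1) T(2) by (intro power_increasing card_image_le) auto
  finally show ?thesis .
qed

lemma min_generators_cyclic_eqI:
  assumes n: "n = 2 * m" "m \<ge> 1" "\<not> 3 dvd m"
    and d: "d = 3 \<or> d = 2 \<and> m mod 8 \<noteq> 4 \<or> d = 1 \<and> odd m"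
    and N: "N > 0" "c dvd 3" "int N dvd nfib m" "int N dvd nfib (Suc m) + 1"
    and E: "E > 1" "c dvd E" "N dvd E" "E ^ d \<le> c * N\<^sup>2"
  shows "min_generators (abelianization (cyclically_presented_group n (cyclic_relator m))) = d"
proof -
  let ?A = "abelianization (cyclically_presented_group n (cyclic_relator m))"
  obtain S where S: "S \<subseteq> carrier ?A" "finite S" "card S \<le> d" "generate ?A S = carrier ?A"
    using cyclic_generating_set[OF n d refl] by blast
  have "c > 0" using N(2) by (auto intro: Nat.gr0I)
  show ?thesis
  proof (rule min_generators_eqI[OF S])
    fix T assume T: "T \<subseteq> carrier ?A" "finite T" "generate ?A T = carrier ?A"
    have "c * N\<^sup>2 \<le> E ^ card T"
      using E by (intro cyclic_generating_set_card_ge[OF n(1,2) \<open>c > 0\<close> N(1,2) _ E(2,3) N(3,4) refl T]) simp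
    then have "E ^ d \<le> E ^ card T"
      using E(4) by linarith
    then show "d \<le> card T"
      using E(1) by (rule power_le_imp_le_exp[rotated])
  qed
qed

section \<open>Common divisors of the coefficients of \<open>x^m + 1\<close> for even
  \<open>m\<close>\<close>

text \<open>For odd \<open>k\<close>, Cassini's identity turns \<open>nfib (Suc k)^2 + 1\<close>
  into a multiple of \<open>nfib k\<close>.\<close>

lemma nfib_dvd_at_double_odd:
  assumes "odd k"
  shows "nfib k dvd nfib (2 * k)" "nfib k dvd nfib (Suc (2 * k)) + 1"
proof -
  show "nfib k dvd nfib (2 * k)" by (simp add: nfib_double)
  have "nfib (Suc (2 * k)) + 1 = nfib k * (2 * nfib k - nfib (Suc k))"
    unfolding nfib_Suc_double using nfib_cassini[of k] assms by (simp add: algebra_simps power2_eq_square)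
  then show "nfib k dvd nfib (Suc (2 * k)) + 1" by simp
qed

text \<open>Here Cassini's identity has the opposite sign, and the Lucas number \<open>L_k\<close>
  factors out instead.\<close>

lemma nfib_dvd_at_double_even:
  assumes "even k"
  shows "2 * nfib (Suc k) + nfib k dvd nfib (2 * k)" "2 * nfib (Suc k) + nfib k dvd nfib (Suc (2 * k)) + 1"
proof -
  show "2 * nfib (Suc k) + nfib k dvd nfib (2 * k)" by (simp add: nfib_double)
  have "nfib (Suc (2 * k)) + 1 = (2 * nfib (Suc k) + nfib k) * nfib (Suc k)"
    unfolding nfib_Suc_double using nfib_cassini[of k] assms by (simp add: algebra_simps power2_eq_square)
  then show "2 * nfib (Suc k) + nfib k dvd nfib (Suc (2 * k)) + 1" by simp
qed

lemma gcd_double_16: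
  "gcd (2 * m) 16 = (if odd m then 2 else if m mod 4 = 2 then 4 else if m mod 8 = 4 then 8 else 16 :: nat)"
proof -
  have "gcd (2 * m) 16 = 2 * gcd m 8"
    using gcd_mult_distrib_nat[of 2 m 8] by simp
  also have "gcd m 8 = gcd (m mod 8) 8"
    by (metis gcd.commute gcd_red_nat)
  finally have *: "gcd (2 * m) 16 = 2 * gcd (m mod 8) 8" .
  have m: "odd m \<longleftrightarrow> odd (m mod 8)" "m mod 4 = m mod 8 mod 4"
    by presburger (simp add: mod_mod_cancel)
  have "m mod 8 < 8" by simp
  then consider "m mod 8 = 0" | "m mod 8 = 1" | "m mod 8 = 2" | "m mod 8 = 3" | "m mod 8 = 4"
    | "m mod 8 = 5" | "m mod 8 = 6" | "m mod 8 = 7"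
    by linarith
  then show ?thesis
    unfolding * m by cases (simp_all add: gcd_non_0_nat)
qed

theorem corollary4p12:
  fixes n :: nat and F G
  assumes "n \<ge> 1" and "gcd n 6 = 2" and "n \<noteq> 4"
    and "F = free_group {..<n}"
    and "G = cyclically_presented_group n
               (free_gen 0 \<otimes>\<^bsub>F\<^esub> free_gen 1 \<otimes>\<^bsub>F\<^esub> free_gen (n div 2 - 1))"
  shows "min_generators (abelianization G) =
           (if gcd n 16 = 2 then 1
            else if gcd n 16 = 4 \<or> gcd n 16 = 16 then 2
            else 3)"
proof -
  have "2 dvd n" using assms(2) by (metis gcd_dvd1)
  then obtain m where n: "n = 2 * m" by blast
  have m1: "m \<ge> 1" using assms(1) n by simp
  have m3: "\<not> 3 dvd m"
  proof
    assume "3 dvd m"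
    then have "6 dvd n" unfolding n using mult_dvd_mono[of 2 2 3 m] by simp
    then show False using assms(2) by (simp add: gcd_nat.absorb2)
  qed
  have G: "G = cyclically_presented_group n (cyclic_relator m)"
    unfolding assms(4,5) free_group_mult_cyclic_relator n by simp
  note eqI = min_generators_cyclic_eqI[OF n m1 m3, folded G]
  have "odd m \<or> m mod 4 = 2 \<or> m mod 8 = 4 \<or> m mod 8 = 0"
    by presburger
  then show ?thesis
  proof (elim disjE)
    assume 1: "odd m"
    have "min_generators (abelianization G) = 1"
      \<comment> \<open>With \<open>N = 1\<close> and \<open>c = 3\<close>, the quotient
        \<open>Z/3\<close> shows that the group is nontrivial.\<close>
      using 1 by (intro eqI[of 1 1 3 3]) auto
    then show ?thesis using 1 unfolding n by (simp add: gcd_double_16)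
  next
    assume 2: "m mod 4 = 2"
    then have "m = 2 * Suc (2 * (m div 4))" by presburger
    then obtain j where j: "m = 2 * Suc (2 * j)" ..
    \<comment> \<open>\<open>j = 0\<close> is the case \<open>n = 4\<close>, where the modulus
      \<open>nfib 1 = 1\<close> would give only a trivial quotient.\<close>
    have "j \<ge> 1" using assms(3) n j by (cases j) auto
    then have N: "nfib (Suc (2 * j)) \<ge> 2" using nfib_sign[of j] by linarith
    have "m mod 8 \<noteq> 4" "even m" using 2 by presburger+
    with N have "min_generators (abelianization G) = 2"
      using nfib_dvd_at_double_odd[of "Suc (2 * j)", folded j]
      by (intro eqI[of 2 "nat (nfib (Suc (2 * j)))" 1 "nat (nfib (Suc (2 * j)))"]) simp_all
    then show ?thesis using 2 \<open>even m\<close> unfolding n by (simp add: gcd_double_16)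
  next
    assume 3: "m mod 8 = 4"
    \<comment> \<open>By periodicity \<open>nfib m\<close> is -3 and \<open>nfib (Suc m)\<close> is
      5 modulo 3, so \<open>N = 3\<close> is admissible. With \<open>c = 3\<close> the quotient is
      \<open>(Z/3)^3\<close>.\<close>
    then have "m = 8 * (m div 8) + 4" "Suc m = 8 * (m div 8) + 5" by presburger+
    then have "nfib m mod 3 = nfib 4 mod 3" "nfib (Suc m) mod 3 = nfib 5 mod 3"
      using nfib_mod3 by metis+
    then have "nfib m mod 3 = 0" "nfib (Suc m) mod 3 = 2" by (simp_all add: nfib_numeral)
    then have "3 dvd nfib m" "3 dvd nfib (Suc m) + 1" by presburger+
    then have "min_generators (abelianization G) = 3"
      by (intro eqI[of 3 3 3 3]) auto
    moreover have "even m" "m mod 4 \<noteq> 2" using 3 by presburger+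
    ultimately show ?thesis using 3 unfolding n by (simp add: gcd_double_16)
  next
    assume 4: "m mod 8 = 0"
    then have "m = 2 * (2 * (m div 4))" by presburger
    then obtain j where j: "m = 2 * (2 * j)" ..
    then obtain i where i: "j = Suc i" using m1 by (cases j) auto
    \<comment> \<open>\<open>?N\<close> is the Lucas number \<open>L_(2j)\<close>. It splits as
      \<open>nfib (Suc (2 * j)) + nfib (Suc (2 * i))\<close>, and both terms are positive by
      \<open>nfib_sign\<close>.\<close>
    let ?N = "2 * nfib (Suc (2 * j)) + nfib (2 * j)"
    have "nfib (Suc (2 * j)) + nfib (2 * j) = nfib (Suc (2 * i))" by (simp add: i)
    then have N: "?N \<ge> 2" using nfib_sign[of i] nfib_sign[of j] i by linarith
    have "min_generators (abelianization G) = 2"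
      using 4 N nfib_dvd_at_double_even[of "2 * j", folded j]
      by (intro eqI[of 2 "nat ?N" 1 "nat ?N"]) simp_all
    moreover have "even m" "m mod 4 \<noteq> 2" using 4 by presburger+
    ultimately show ?thesis using 4 unfolding n by (simp add: gcd_double_16)
  qed
qed

end
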